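(* In every psi-calculus, strong bisimilarity $\dot\sim$ (i.e. $\dot\sim_{\mathbf 1}$) and context bisimilarity $\dot\sim^c$ coincide: for all agents $P,Q$, $P \mathrel{\dot\sim} Q$ if and only if $P \mathrel{\dot\sim^c} Q$.
   Context: Names: a countably infinite set $\mathcal N$ of atomic names. A nominal set is a set equipped with name swapping operations $(a\;b)\cdot X$ satisfying the usual axioms; the support $\mathrm n(X)$ of an element is the set of names affected by swappings, assumed finite; $a \# X$ ("$a$ fresh for $X$") means $a\notin \mathrm n(X)$, and $A\#X$ for a set/sequence $A$ means every element of $A$ is fresh for $X$. A function/relation is equivariant if it commutes with all swappings. $\tilde a$ denotes a finite sequence of names (also used as the set of its elements). Psi-calculus: given by three nominal datatypes $\mathbf T$ (terms, ranged over by $M,N,K,L$), $\mathbf C$ (conditions, $\varphi$), $\mathbf A$ (assertions, $\Psi$), equivariant operators $\leftrightarrow:\mathbf T\times\mathbf T\to\mathbf C$ (channel equivalence), $\otimes:\mathbf A\times\mathbf A\to\mathbf A$ (composition), $\mathbf 1\in\mathbf A$ (unit), $\vdash\subseteq\mathbf A\times\mathbf C$ (entailment), and equivariant substitution functions $X[\tilde a:=\tilde T]$ (substituting terms for distinct names) on $\mathbf T,\mathbf C,\mathbf A$ satisfying: (S1) if $\tilde a\subseteq\mathrm n(X)$ and $b\in\mathrm n(\tilde T)$ then $b\in\mathrm n(X[\tilde a:=\tilde T])$; (S2) if $\tilde b\# X,\tilde a$ then $X[\tilde a:=\tilde T]=((\tilde b\;\tilde a)\cdot X)[\tilde b:=\tilde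 T]$. Assertions are equivalent, $\Psi\simeq\Psi'$, if for all $\varphi$: $\Psi\vdash\varphi\iff\Psi'\vdash\varphi$. Required: $\Psi\vdash M\leftrightarrow N\Rightarrow\Psi\vdash N\leftrightarrow M$; $\Psi\vdash M\leftrightarrow N\wedge\Psi\vdash N\leftrightarrow L\Rightarrow\Psi\vdash M\leftrightarrow L$; $\Psi\simeq\Psi'\Rightarrow\Psi\otimes\Psi''\simeq\Psi'\otimes\Psi''$; $\Psi\otimes\mathbf 1\simeq\Psi$; $(\Psi\otimes\Psi')\otimes\Psi''\simeq\Psi\otimes(\Psi'\otimes\Psi'')$; $\Psi\otimes\Psi'\simeq\Psi'\otimes\Psi$. Frames: $(\nu\tilde b)\Psi$ with $\tilde b$ binding into $\Psi$, identified up to alpha-equivalence; $(\nu\tilde b_1)\Psi_1\otimes(\nu\tilde b_2)\Psi_2=(\nu\tilde b_1\tilde b_2)(\Psi_1\otimes\Psi_2)$ with $\tilde b_1\#\tilde b_2,\Psi_2$ and $\tilde b_2\#\tilde b_1,\Psi_1$; $F\vdash\varphi$ iff some alpha-variant $(\nu\tilde b)\Psi$ of $F$ has $\tilde b\#\varphi$ and $\Psi\vdash\varphi$; $F\simeq G$ iff for all $\varphi$, $F\vdash\varphi\iff G\vdash\varphi$; an assertion $\Psi$ is identified with the frame $(\nu\epsilon)\Psi$. Agents: $\mathbf 0$; $\overline M N.P$ (output); $\underline M(\lambda\tilde x)N.P$ (input, $\tilde x\subseteq\mathrm n(N)$ without duplicates, binding in $N$ and $P$); $\mathbf{case}\ \varphi_1:P_1\,[\!]\cdots[\!]\,\varphi_n:P_n$;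 $(\nu a)P$ (binds $a$); $P\mid Q$; $!P$; $(\!|\Psi|\!)$ (assertion). Agents are identified up to alpha-equivalence. In $!P$ and in each branch $P_i$ of a case, every assertion must occur under an input or output prefix. Substitution on agents is defined homomorphically from substitution on terms, conditions, assertions, avoiding capture. Frame of an agent: $\mathcal F(\mathbf 0)=\mathcal F(\text{input})=\mathcal F(\text{output})=\mathcal F(\mathbf{case}\ldots)=\mathcal F(!P)=\mathbf 1$, $\mathcal F((\!|\Psi|\!))=\Psi$, $\mathcal F(P\mid Q)=\mathcal F(P)\otimes\mathcal F(Q)$, $\mathcal F((\nu b)P)=(\nu b)\mathcal F(P)$. We write $\mathcal F(P)=(\nu\tilde b_P)\Psi_P$. Actions: output $\overline M(\nu\tilde a)N$ with $\tilde a\subseteq\mathrm n(N)$, input $\underline M N$, and $\tau$; $\mathrm{bn}(\overline M(\nu\tilde a)N)=\tilde a$, otherwise $\emptyset$; $\mathrm n(\tau)=\emptyset$, else $\mathrm n(M)\cup\mathrm n(N)$; $M$ is the subject. Transitions $\Psi\rhd P\xrightarrow{\alpha}P'$ are the least relation closed under (symmetric versions of Com and Par included): In: $\Psi\vdash M\leftrightarrow K$ implies $\Psi\rhd\underline M(\lambda\tilde y)N.P\xrightarrow{\underline K\,N[\tilde y:=\tilde L]}P[\tilde y:=\tilde L]$ for any $\tilde L$. Out: $\Psi\vdash M\leftrightarrow K$ implies $\Psi\rhd\overline MN.P\xrightarrow{\overline KN}P$. Case: $\Psi\rhd P_i\xrightarrow\alpha P'$ and $\Psi\vdash\varphi_i$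 imply $\Psi\rhd\mathbf{case}\ \tilde\varphi:\tilde P\xrightarrow\alpha P'$. Com: with $\mathcal F(P)=(\nu\tilde b_P)\Psi_P$, $\mathcal F(Q)=(\nu\tilde b_Q)\Psi_Q$, $\tilde b_P\#\Psi,\tilde b_Q,Q,M,P$, $\tilde b_Q\#\Psi,\tilde b_P,P,K,Q$: if $\Psi_Q\otimes\Psi\rhd P\xrightarrow{\overline M(\nu\tilde a)N}P'$, $\Psi_P\otimes\Psi\rhd Q\xrightarrow{\underline KN}Q'$, $\Psi\otimes\Psi_P\otimes\Psi_Q\vdash M\leftrightarrow K$ and $\tilde a\#Q$, then $\Psi\rhd P\mid Q\xrightarrow\tau(\nu\tilde a)(P'\mid Q')$. Par: with $\mathcal F(Q)=(\nu\tilde b_Q)\Psi_Q$, $\tilde b_Q\#\Psi,P,\alpha$: if $\Psi_Q\otimes\Psi\rhd P\xrightarrow\alpha P'$ and $\mathrm{bn}(\alpha)\#Q$ then $\Psi\rhd P\mid Q\xrightarrow\alpha P'\mid Q$. Scope: $\Psi\rhd P\xrightarrow\alpha P'$, $b\#\alpha,\Psi$ imply $\Psi\rhd(\nu b)P\xrightarrow\alpha(\nu b)P'$. Open: $\Psi\rhd P\xrightarrow{\overline M(\nu\tilde a)N}P'$, $b\#\tilde a,\Psi,M$, $b\in\mathrm n(N)$ imply $\Psi\rhd(\nu b)P\xrightarrow{\overline M(\nu\tilde a\cup\{b\})N}P'$. Rep: $\Psi\rhd P\mid !P\xrightarrow\alpha P'$ implies $\Psi\rhd !P\xrightarrow\alpha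 P'$. $\mathrm{bn}(\alpha)$ binds into the object and derivative; transitions are identified up to alpha-equivalence. $P\xrightarrow\alpha P'$ means $\mathbf 1\rhd P\xrightarrow\alpha P'$. Bisimulation: a ternary relation $\mathcal R$ on (assertion, agent, agent) such that $\mathcal R(\Psi,P,Q)$ implies (1) $\Psi\otimes\mathcal F(P)\simeq\Psi\otimes\mathcal F(Q)$; (2) $\mathcal R(\Psi,Q,P)$; (3) $\mathcal R(\Psi\otimes\Psi',P,Q)$ for all $\Psi'$; (4) for all $\alpha,P'$ with $\mathrm{bn}(\alpha)\#\Psi,Q$, if $\Psi\rhd P\xrightarrow\alpha P'$ then there is $Q'$ with $\Psi\rhd Q\xrightarrow\alpha Q'$ and $\mathcal R(\Psi,P',Q')$. $P\mathrel{\dot\sim_\Psi}Q$ iff some bisimulation contains $(\Psi,P,Q)$; $\dot\sim$ is $\dot\sim_{\mathbf 1}$. Context bisimulation: a binary relation $\mathcal R$ on agents such that $\mathcal R(P,Q)$ implies (1) $\mathcal F(P)\simeq\mathcal F(Q)$; (2) $\mathcal R(Q,P)$; (3) for all $\Psi$, $\mathcal R((\!|\Psi|\!)\mid P,(\!|\Psi|\!)\mid Q)$; (4) for all $\alpha,P'$ with $\mathrm{bn}(\alpha)\#Q$, if $\mathbf 1\rhd P\xrightarrow\alpha P'$ then there is $Q'$ with $\mathbf 1\rhd Q\xrightarrow\alpha Q'$ and $\mathcal R(P',Q')$. $P\mathrel{\dot\sim^c}Q$ iff some context bisimulation contains $(P,Q)$. *)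

theory Defs
  imports Main
begin

type_synonym name = nat

definition swapN :: "name \<Rightarrow> name \<Rightarrow> name \<Rightarrow> name" where
  "swapN a b c = (if c = a then b else if c = b then a else c)"

text \<open>Finite permutations are represented as lists of swappings (applied right to left).\<close>
type_synonym perm = "(name \<times> name) list"

definition permN :: "perm \<Rightarrow> name \<Rightarrow> name" where
  "permN p c = foldr (\<lambda>(a,b) x. swapN a b x) p c"

definition permBy :: "(name \<Rightarrow> name \<Rightarrow> 'x \<Rightarrow> 'x) \<Rightarrow> perm \<Rightarrow> 'x \<Rightarrow> 'x" where
  "permBy sw p x = foldr (\<lambda>(a,b) y. sw a b y) p x"

definition supp_of :: "(name \<Rightarrow> name \<Rightarrow> 'x \<Rightarrow> 'x) \<Rightarrow> 'x \<Rightarrow> name set" where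
  "supp_of sw x = {a. infinite {b. sw a b x \<noteq> x}}"

definition nominal_set :: "(name \<Rightarrow> name \<Rightarrow> 'x \<Rightarrow> 'x) \<Rightarrow> bool" where
  "nominal_set sw \<longleftrightarrow>
     (\<forall>a x. sw a a x = x) \<and>
     (\<forall>a b x. sw a b (sw a b x) = x) \<and>
     (\<forall>a b c d x. sw a b (sw c d x) = sw (swapN a b c) (swapN a b d) (sw a b x)) \<and>
     (\<forall>x. finite (supp_of sw x))"

record ('t,'c,'a) psi_ops =
  swT :: "name \<Rightarrow> name \<Rightarrow> 't \<Rightarrow> 't"
  swC :: "name \<Rightarrow> name \<Rightarrow> 'c \<Rightarrow> 'c"
  swA :: "name \<Rightarrow> name \<Rightarrow> 'a \<Rightarrow> 'a"
  chEq :: "'t \<Rightarrow> 't \<Rightarrow> 'c"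
  comp :: "'a \<Rightarrow> 'a \<Rightarrow> 'a"
  unitA :: 'a
  ent :: "'a \<Rightarrow> 'c \<Rightarrow> bool"
  substT :: "'t \<Rightarrow> name list \<Rightarrow> 't list \<Rightarrow> 't"
  substC :: "'c \<Rightarrow> name list \<Rightarrow> 't list \<Rightarrow> 'c"
  substA :: "'a \<Rightarrow> name list \<Rightarrow> 't list \<Rightarrow> 'a"

definition suppT :: "('t,'c,'a) psi_ops \<Rightarrow> 't \<Rightarrow> name set" where
  "suppT S = supp_of (swT S)"
definition suppC :: "('t,'c,'a) psi_ops \<Rightarrow> 'c \<Rightarrow> name set" where
  "suppC S = supp_of (swC S)"
definition suppA :: "('t,'c,'a) psi_ops \<Rightarrow> 'a \<Rightarrow> name set" where
  "suppA S = supp_of (swA S)"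

definition suppTs :: "('t,'c,'a) psi_ops \<Rightarrow> 't list \<Rightarrow> name set" where
  "suppTs S Ts = (\<Union>T\<in>set Ts. suppT S T)"

definition seqSwap :: "name list \<Rightarrow> name list \<Rightarrow> perm" where
  "seqSwap bs as = zip bs as"

text \<open>Substitution axioms S1 and S2 for a substitution function on one nominal datatype
  (substitution is only required to be meaningful for distinct names and equally long term lists).\<close>
definition subst_axioms ::
  "(name \<Rightarrow> name \<Rightarrow> 'x \<Rightarrow> 'x) \<Rightarrow> ('x \<Rightarrow> name list \<Rightarrow> 't list \<Rightarrow> 'x) \<Rightarrow>
   (name \<Rightarrow> name \<Rightarrow> 't \<Rightarrow> 't) \<Rightarrow> bool" where
  "subst_axioms sw sub swt \<longleftrightarrow>
     (\<forall>a b X xs Ts. sw a b (sub X xs Ts) = sub (sw a b X) (map (swapN a b) xs) (map (swt a b) Ts)) \<and>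
     (\<forall>X xs Ts b. distinct xs \<and> length xs = length Ts \<and> set xs \<subseteq> supp_of sw X \<and>
         b \<in> (\<Union>T\<in>set Ts. supp_of swt T) \<longrightarrow> b \<in> supp_of sw (sub X xs Ts)) \<and>
     (\<forall>X xs Ts bs. distinct xs \<and> length xs = length Ts \<and> distinct bs \<and> length bs = length xs \<and>
         set bs \<inter> (supp_of sw X \<union> set xs) = {} \<longrightarrow>
         sub X xs Ts = sub (permBy sw (seqSwap bs xs) X) bs Ts)"

definition assert_eq :: "('t,'c,'a) psi_ops \<Rightarrow> 'a \<Rightarrow> 'a \<Rightarrow> bool" where
  "assert_eq S \<Psi> \<Psi>' \<longleftrightarrow> (\<forall>\<phi>. ent S \<Psi> \<phi> \<longleftrightarrow> ent S \<Psi>' \<phi>)"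

definition psi_calculus :: "('t,'c,'a) psi_ops \<Rightarrow> bool" where
  "psi_calculus S \<longleftrightarrow>
     nominal_set (swT S) \<and> nominal_set (swC S) \<and> nominal_set (swA S) \<and>
     (\<forall>a b M N. swC S a b (chEq S M N) = chEq S (swT S a b M) (swT S a b N)) \<and>
     (\<forall>a b \<Psi> \<Psi>'. swA S a b (comp S \<Psi> \<Psi>') = comp S (swA S a b \<Psi>) (swA S a b \<Psi>')) \<and>
     (\<forall>a b. swA S a b (unitA S) = unitA S) \<and>
     (\<forall>a b \<Psi> \<phi>. ent S \<Psi> \<phi> \<longrightarrow> ent S (swA S a b \<Psi>) (swC S a b \<phi>)) \<and>
     subst_axioms (swT S) (substT S) (swT S) \<and>
     subst_axioms (swC S) (substC S) (swT S) \<and>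
     subst_axioms (swA S) (substA S) (swT S) \<and>
     (\<forall>\<Psi> M N. ent S \<Psi> (chEq S M N) \<longrightarrow> ent S \<Psi> (chEq S N M)) \<and>
     (\<forall>\<Psi> M N L. ent S \<Psi> (chEq S M N) \<and> ent S \<Psi> (chEq S N L) \<longrightarrow> ent S \<Psi> (chEq S M L)) \<and>
     (\<forall>\<Psi> \<Psi>' \<Psi>''. assert_eq S \<Psi> \<Psi>' \<longrightarrow> assert_eq S (comp S \<Psi> \<Psi>'') (comp S \<Psi>' \<Psi>'')) \<and>
     (\<forall>\<Psi>. assert_eq S (comp S \<Psi> (unitA S)) \<Psi>) \<and>
     (\<forall>\<Psi> \<Psi>' \<Psi>''. assert_eq S (comp S (comp S \<Psi> \<Psi>') \<Psi>'') (comp S \<Psi> (comp S \<Psi>' \<Psi>''))) \<and>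
     (\<forall>\<Psi> \<Psi>'. assert_eq S (comp S \<Psi> \<Psi>') (comp S \<Psi>' \<Psi>))"

section \<open>Agents (raw syntax; identified up to alpha-equivalence below)\<close>

datatype ('t,'c,'a) agent =
    PNil
  | POut 't 't "('t,'c,'a) agent"
  | PIn 't "name list" 't "('t,'c,'a) agent"
  | PCase "('c \<times> ('t,'c,'a) agent) list"
  | PRes name "('t,'c,'a) agent"
  | PPar "('t,'c,'a) agent" "('t,'c,'a) agent"
  | PBang "('t,'c,'a) agent"
  | PAssert 'a

primrec swP :: "('t,'c,'a) psi_ops \<Rightarrow> name \<Rightarrow> name \<Rightarrow> ('t,'c,'a) agent \<Rightarrow> ('t,'c,'a) agent" where
  "swP S a b PNil = PNil"
| "swP S a b (POut M N P) = POut (swT S a b M) (swT S a b N) (swP S a b P)"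
| "swP S a b (PIn M xs N P) = PIn (swT S a b M) (map (swapN a b) xs) (swT S a b N) (swP S a b P)"
| "swP S a b (PCase cs) = PCase (map (map_prod (swC S a b) (swP S a b)) cs)"
| "swP S a b (PRes x P) = PRes (swapN a b x) (swP S a b P)"
| "swP S a b (PPar P Q) = PPar (swP S a b P) (swP S a b Q)"
| "swP S a b (PBang P) = PBang (swP S a b P)"
| "swP S a b (PAssert \<Psi>) = PAssert (swA S a b \<Psi>)"

definition permP :: "('t,'c,'a) psi_ops \<Rightarrow> perm \<Rightarrow> ('t,'c,'a) agent \<Rightarrow> ('t,'c,'a) agent" where
  "permP S = permBy (swP S)"

text \<open>Free names (the support of the alpha-equivalence class).\<close>
primrec fnP :: "('t,'c,'a) psi_ops \<Rightarrow> ('t,'c,'a) agent \<Rightarrow> name set" where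
  "fnP S PNil = {}"
| "fnP S (POut M N P) = suppT S M \<union> suppT S N \<union> fnP S P"
| "fnP S (PIn M xs N P) = suppT S M \<union> ((suppT S N \<union> fnP S P) - set xs)"
| "fnP S (PCase cs) = \<Union>(set (map (\<lambda>(A, B). A \<union> B) (map (map_prod (suppC S) (fnP S)) cs)))"
| "fnP S (PRes x P) = fnP S P - {x}"
| "fnP S (PPar P Q) = fnP S P \<union> fnP S Q"
| "fnP S (PBang P) = fnP S P"
| "fnP S (PAssert \<Psi>) = suppA S \<Psi>"

primrec bnP :: "('t,'c,'a) agent \<Rightarrow> name set" where
  "bnP PNil = {}"
| "bnP (POut M N P) = bnP P"
| "bnP (PIn M xs N P) = set xs \<union> bnP P"
| "bnP (PCase cs) = \<Union>(set (map snd (map (map_prod id bnP) cs)))"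
| "bnP (PRes x P) = insert x (bnP P)"
| "bnP (PPar P Q) = bnP P \<union> bnP Q"
| "bnP (PBang P) = bnP P"
| "bnP (PAssert \<Psi>) = {}"

text \<open>Homomorphic substitution; it is capture-avoiding when applied to an alpha-variant
  whose bound names are fresh for the substituted names and terms (see rule In below).\<close>
primrec rsubst :: "('t,'c,'a) psi_ops \<Rightarrow> ('t,'c,'a) agent \<Rightarrow> name list \<Rightarrow> 't list \<Rightarrow> ('t,'c,'a) agent" where
  "rsubst S PNil ys Ls = PNil"
| "rsubst S (POut M N P) ys Ls = POut (substT S M ys Ls) (substT S N ys Ls) (rsubst S P ys Ls)"
| "rsubst S (PIn M xs N P) ys Ls = PIn (substT S M ys Ls) xs (substT S N ys Ls) (rsubst S P ys Ls)"
| "rsubst S (PCase cs) ys Ls = PCase (map (map_prod (\<lambda>\<phi>. substC S \<phi> ys Ls) (\<lambda>P. rsubst S P ys Ls)) cs)"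
| "rsubst S (PRes x P) ys Ls = PRes x (rsubst S P ys Ls)"
| "rsubst S (PPar P Q) ys Ls = PPar (rsubst S P ys Ls) (rsubst S Q ys Ls)"
| "rsubst S (PBang P) ys Ls = PBang (rsubst S P ys Ls)"
| "rsubst S (PAssert \<Psi>) ys Ls = PAssert (substA S \<Psi> ys Ls)"

definition fixes_names :: "perm \<Rightarrow> name set \<Rightarrow> bool" where
  "fixes_names p A \<longleftrightarrow> (\<forall>a\<in>A. permN p a = a)"

inductive alpha :: "('t,'c,'a) psi_ops \<Rightarrow> ('t,'c,'a) agent \<Rightarrow> ('t,'c,'a) agent \<Rightarrow> bool"
  for S :: "('t,'c,'a) psi_ops" where
  aNil: "alpha S PNil PNil"
| aOut: "alpha S P P' \<Longrightarrow> alpha S (POut M N P) (POut M N P')"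
| aIn: "(suppT S N \<union> fnP S P) - set xs = (suppT S N' \<union> fnP S P') - set ys \<Longrightarrow>
        fixes_names p ((suppT S N \<union> fnP S P) - set xs) \<Longrightarrow>
        map (permN p) xs = ys \<Longrightarrow> permBy (swT S) p N = N' \<Longrightarrow>
        alpha S (permP S p P) P' \<Longrightarrow>
        alpha S (PIn M xs N P) (PIn M ys N' P')"
| aCase: "list_all2 (rel_prod (=) (alpha S)) cs cs' \<Longrightarrow>
          alpha S (PCase cs) (PCase cs')"
| aRes: "fnP S P - {x} = fnP S P' - {y} \<Longrightarrow> fixes_names p (fnP S P - {x}) \<Longrightarrow>
         permN p x = y \<Longrightarrow> alpha S (permP S p P) P' \<Longrightarrow>
         alpha S (PRes x P) (PRes y P')"
| aPar: "alpha S P P' \<Longrightarrow> alpha S Q Q' \<Longrightarrow> alpha S (PPar P Q) (PPar P' Q')"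
| aBang: "alpha S P P' \<Longrightarrow> alpha S (PBang P) (PBang P')"
| aAssert: "alpha S (PAssert \<Psi>) (PAssert \<Psi>)"
monos list.rel_mono prod.rel_mono

primrec guarded :: "('t,'c,'a) agent \<Rightarrow> bool" where
  "guarded PNil = True"
| "guarded (POut M N P) = True"
| "guarded (PIn M xs N P) = True"
| "guarded (PCase cs) = list_all snd (map (map_prod id guarded) cs)"
| "guarded (PRes x P) = guarded P"
| "guarded (PPar P Q) = (guarded P \<and> guarded Q)"
| "guarded (PBang P) = guarded P"
| "guarded (PAssert \<Psi>) = False"

primrec wf_agent :: "('t,'c,'a) psi_ops \<Rightarrow> ('t,'c,'a) agent \<Rightarrow> bool" where
  "wf_agent S PNil = True"
| "wf_agent S (POut M N P) = wf_agent S P"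
| "wf_agent S (PIn M xs N P) = (distinct xs \<and> set xs \<subseteq> suppT S N \<and> wf_agent S P)"
| "wf_agent S (PCase cs) = list_all snd (map (map_prod id (\<lambda>P. guarded P \<and> wf_agent S P)) cs)"
| "wf_agent S (PRes x P) = wf_agent S P"
| "wf_agent S (PPar P Q) = (wf_agent S P \<and> wf_agent S Q)"
| "wf_agent S (PBang P) = (guarded P \<and> wf_agent S P)"
| "wf_agent S (PAssert \<Psi>) = True"

text \<open>A raw frame (\<nu> bs)\<Psi>; frames are identified up to alpha-equivalence.\<close>
type_synonym 'a frame = "name list \<times> 'a"

definition alphaF :: "('t,'c,'a) psi_ops \<Rightarrow> 'a frame \<Rightarrow> 'a frame \<Rightarrow> bool" where
  "alphaF S F G \<longleftrightarrow> (case F of (bs, \<Psi>) \<Rightarrow> case G of (cs, \<Psi>') \<Rightarrow>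
     (\<exists>p. suppA S \<Psi> - set bs = suppA S \<Psi>' - set cs \<and> fixes_names p (suppA S \<Psi> - set bs) \<and>
          map (permN p) bs = cs \<and> permBy (swA S) p \<Psi> = \<Psi>'))"

inductive isFrame :: "('t,'c,'a) psi_ops \<Rightarrow> ('t,'c,'a) agent \<Rightarrow> 'a frame \<Rightarrow> bool"
  for S :: "('t,'c,'a) psi_ops" where
  fNil: "alphaF S F ([], unitA S) \<Longrightarrow> isFrame S PNil F"
| fOut: "alphaF S F ([], unitA S) \<Longrightarrow> isFrame S (POut M N P) F"
| fIn: "alphaF S F ([], unitA S) \<Longrightarrow> isFrame S (PIn M xs N P) F"
| fCase: "alphaF S F ([], unitA S) \<Longrightarrow> isFrame S (PCase cs) F"
| fBang: "alphaF S F ([], unitA S) \<Longrightarrow> isFrame S (PBang P) F"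
| fAssert: "alphaF S F ([], \<Psi>) \<Longrightarrow> isFrame S (PAssert \<Psi>) F"
| fPar: "isFrame S P (b1, \<Psi>1) \<Longrightarrow> isFrame S Q (b2, \<Psi>2) \<Longrightarrow>
         set b1 \<inter> (set b2 \<union> suppA S \<Psi>2) = {} \<Longrightarrow> set b2 \<inter> (set b1 \<union> suppA S \<Psi>1) = {} \<Longrightarrow>
         alphaF S F (b1 @ b2, comp S \<Psi>1 \<Psi>2) \<Longrightarrow> isFrame S (PPar P Q) F"
| fRes: "isFrame S P (bs, \<Psi>) \<Longrightarrow> alphaF S F (x # bs, \<Psi>) \<Longrightarrow> isFrame S (PRes x P) F"

definition frame_ent :: "('t,'c,'a) psi_ops \<Rightarrow> 'a frame \<Rightarrow> 'c \<Rightarrow> bool" where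
  "frame_ent S F \<phi> \<longleftrightarrow> (\<exists>bs \<Psi>. alphaF S F (bs, \<Psi>) \<and> set bs \<inter> suppC S \<phi> = {} \<and> ent S \<Psi> \<phi>)"

definition frame_eq :: "('t,'c,'a) psi_ops \<Rightarrow> 'a frame \<Rightarrow> 'a frame \<Rightarrow> bool" where
  "frame_eq S F G \<longleftrightarrow> (\<forall>\<phi>. frame_ent S F \<phi> \<longleftrightarrow> frame_ent S G \<phi>)"

text \<open>G is (an alpha-variant of) the frame \<Psi> \<otimes> F(P).\<close>
definition extFrame :: "('t,'c,'a) psi_ops \<Rightarrow> 'a \<Rightarrow> ('t,'c,'a) agent \<Rightarrow> 'a frame \<Rightarrow> bool" where
  "extFrame S \<Psi> P G \<longleftrightarrow>
     (\<exists>bs \<Psi>P. isFrame S P (bs, \<Psi>P) \<and> set bs \<inter> suppA S \<Psi> = {} \<and> alphaF S G (bs, comp S \<Psi> \<Psi>P))"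

datatype ('t) action = AOut 't "name list" 't | AIn 't 't | ATau

primrec bnAct :: "'t action \<Rightarrow> name set" where
  "bnAct (AOut M as N) = set as"
| "bnAct (AIn M N) = {}"
| "bnAct ATau = {}"

primrec nAct :: "('t,'c,'a) psi_ops \<Rightarrow> 't action \<Rightarrow> name set" where
  "nAct S (AOut M as N) = suppT S M \<union> suppT S N"
| "nAct S (AIn M N) = suppT S M \<union> suppT S N"
| "nAct S ATau = {}"

text \<open>Alpha-equivalence of residuals (action, derivative); output bound names bind
  (as a set) into the object and the derivative.\<close>
fun alphaRes :: "('t,'c,'a) psi_ops \<Rightarrow> 't action \<Rightarrow> ('t,'c,'a) agent \<Rightarrow>
                  't action \<Rightarrow> ('t,'c,'a) agent \<Rightarrow> bool" where
  "alphaRes S (AOut M as N) P (AOut M' cs N') P' \<longleftrightarrow>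
     M = M' \<and>
     (\<exists>p. (suppT S N \<union> fnP S P) - set as = (suppT S N' \<union> fnP S P') - set cs \<and>
          fixes_names p ((suppT S N \<union> fnP S P) - set as) \<and>
          permN p ` set as = set cs \<and> permBy (swT S) p N = N' \<and> alpha S (permP S p P) P')"
| "alphaRes S (AIn M N) P (AIn M' N') P' \<longleftrightarrow> M = M' \<and> N = N' \<and> alpha S P P'"
| "alphaRes S ATau P ATau P' \<longleftrightarrow> alpha S P P'"
| "alphaRes S _ _ _ _ \<longleftrightarrow> False"

definition resList :: "name list \<Rightarrow> ('t,'c,'a) agent \<Rightarrow> ('t,'c,'a) agent" where
  "resList as P = foldr PRes as P"

inductive trans :: "('t,'c,'a) psi_ops \<Rightarrow> 'a \<Rightarrow> ('t,'c,'a) agent \<Rightarrow> 't action \<Rightarrow> ('t,'c,'a) agent \<Rightarrow> bool"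
  for S :: "('t,'c,'a) psi_ops" where
  In: "ent S \<Psi> (chEq S M K) \<Longrightarrow> length Ls = length ys \<Longrightarrow>
       alpha S P P0 \<Longrightarrow> bnP P0 \<inter> (set ys \<union> suppTs S Ls) = {} \<Longrightarrow>
       trans S \<Psi> (PIn M ys N P) (AIn K (substT S N ys Ls)) (rsubst S P0 ys Ls)"
| Out: "ent S \<Psi> (chEq S M K) \<Longrightarrow> trans S \<Psi> (POut M N P) (AOut K [] N) P"
| Case: "trans S \<Psi> P \<alpha> P' \<Longrightarrow> (\<phi>, P) \<in> set cs \<Longrightarrow> ent S \<Psi> \<phi> \<Longrightarrow>
         trans S \<Psi> (PCase cs) \<alpha> P'"
| Com1: "isFrame S P (bP, \<Psi>P) \<Longrightarrow> isFrame S Q (bQ, \<Psi>Q) \<Longrightarrow>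
         set bP \<inter> (suppA S \<Psi> \<union> set bQ \<union> fnP S Q \<union> suppT S M \<union> fnP S P) = {} \<Longrightarrow>
         set bQ \<inter> (suppA S \<Psi> \<union> set bP \<union> fnP S P \<union> suppT S K \<union> fnP S Q) = {} \<Longrightarrow>
         trans S (comp S \<Psi>Q \<Psi>) P (AOut M as N) P' \<Longrightarrow>
         trans S (comp S \<Psi>P \<Psi>) Q (AIn K N) Q' \<Longrightarrow>
         ent S (comp S (comp S \<Psi> \<Psi>P) \<Psi>Q) (chEq S M K) \<Longrightarrow>
         set as \<inter> fnP S Q = {} \<Longrightarrow>
         trans S \<Psi> (PPar P Q) ATau (resList as (PPar P' Q'))"
| Com2: "isFrame S P (bP, \<Psi>P) \<Longrightarrow> isFrame S Q (bQ, \<Psi>Q) \<Longrightarrow>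
         set bP \<inter> (suppA S \<Psi> \<union> set bQ \<union> fnP S Q \<union> suppT S K \<union> fnP S P) = {} \<Longrightarrow>
         set bQ \<inter> (suppA S \<Psi> \<union> set bP \<union> fnP S P \<union> suppT S M \<union> fnP S Q) = {} \<Longrightarrow>
         trans S (comp S \<Psi>Q \<Psi>) P (AIn K N) P' \<Longrightarrow>
         trans S (comp S \<Psi>P \<Psi>) Q (AOut M as N) Q' \<Longrightarrow>
         ent S (comp S (comp S \<Psi> \<Psi>Q) \<Psi>P) (chEq S M K) \<Longrightarrow>
         set as \<inter> fnP S P = {} \<Longrightarrow>
         trans S \<Psi> (PPar P Q) ATau (resList as (PPar P' Q'))"
| Par1: "isFrame S Q (bQ, \<Psi>Q) \<Longrightarrow>
         set bQ \<inter> (suppA S \<Psi> \<union> fnP S P \<union> nAct S \<alpha>) = {} \<Longrightarrow>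
         trans S (comp S \<Psi>Q \<Psi>) P \<alpha> P' \<Longrightarrow> bnAct \<alpha> \<inter> fnP S Q = {} \<Longrightarrow>
         trans S \<Psi> (PPar P Q) \<alpha> (PPar P' Q)"
| Par2: "isFrame S P (bP, \<Psi>P) \<Longrightarrow>
         set bP \<inter> (suppA S \<Psi> \<union> fnP S Q \<union> nAct S \<alpha>) = {} \<Longrightarrow>
         trans S (comp S \<Psi>P \<Psi>) Q \<alpha> Q' \<Longrightarrow> bnAct \<alpha> \<inter> fnP S P = {} \<Longrightarrow>
         trans S \<Psi> (PPar P Q) \<alpha> (PPar P Q')"
| Scope: "trans S \<Psi> P \<alpha> P' \<Longrightarrow> b \<notin> nAct S \<alpha> \<Longrightarrow> b \<notin> suppA S \<Psi> \<Longrightarrow>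
          trans S \<Psi> (PRes b P) \<alpha> (PRes b P')"
| Open: "trans S \<Psi> P (AOut M as N) P' \<Longrightarrow> b \<notin> set as \<Longrightarrow> b \<notin> suppA S \<Psi> \<Longrightarrow>
         b \<notin> suppT S M \<Longrightarrow> b \<in> suppT S N \<Longrightarrow>
         trans S \<Psi> (PRes b P) (AOut M (b # as) N) P'"
| Rep: "trans S \<Psi> (PPar P (PBang P)) \<alpha> P' \<Longrightarrow> trans S \<Psi> (PBang P) \<alpha> P'"
| Alpha: "trans S \<Psi> P \<alpha> P' \<Longrightarrow> alpha S P Q \<Longrightarrow> alphaRes S \<alpha> P' \<beta> Q' \<Longrightarrow>
          trans S \<Psi> Q \<beta> Q'"

definition is_bisimulation :: "('t,'c,'a) psi_ops \<Rightarrow> ('a \<Rightarrow> ('t,'c,'a) agent \<Rightarrow> ('t,'c,'a) agent \<Rightarrow> bool) \<Rightarrow> bool" where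
  "is_bisimulation S R \<longleftrightarrow> (\<forall>\<Psi> P Q. R \<Psi> P Q \<longrightarrow>
     (\<forall>F G. extFrame S \<Psi> P F \<longrightarrow> extFrame S \<Psi> Q G \<longrightarrow> frame_eq S F G) \<and>
     R \<Psi> Q P \<and>
     (\<forall>\<Psi>'. R (comp S \<Psi> \<Psi>') P Q) \<and>
     (\<forall>\<alpha> P'. bnAct \<alpha> \<inter> (suppA S \<Psi> \<union> fnP S Q) = {} \<longrightarrow> trans S \<Psi> P \<alpha> P' \<longrightarrow>
         (\<exists>Q'. trans S \<Psi> Q \<alpha> Q' \<and> R \<Psi> P' Q')))"

definition bisim :: "('t,'c,'a) psi_ops \<Rightarrow> 'a \<Rightarrow> ('t,'c,'a) agent \<Rightarrow> ('t,'c,'a) agent \<Rightarrow> bool" where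
  "bisim S \<Psi> P Q \<longleftrightarrow> (\<exists>R. is_bisimulation S R \<and> R \<Psi> P Q)"

definition is_ctx_bisimulation :: "('t,'c,'a) psi_ops \<Rightarrow> (('t,'c,'a) agent \<Rightarrow> ('t,'c,'a) agent \<Rightarrow> bool) \<Rightarrow> bool" where
  "is_ctx_bisimulation S R \<longleftrightarrow> (\<forall>P Q. R P Q \<longrightarrow>
     (\<forall>F G. isFrame S P F \<longrightarrow> isFrame S Q G \<longrightarrow> frame_eq S F G) \<and>
     R Q P \<and>
     (\<forall>\<Psi>. R (PPar (PAssert \<Psi>) P) (PPar (PAssert \<Psi>) Q)) \<and>
     (\<forall>\<alpha> P'. bnAct \<alpha> \<inter> fnP S Q = {} \<longrightarrow> trans S (unitA S) P \<alpha> P' \<longrightarrow>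
         (\<exists>Q'. trans S (unitA S) Q \<alpha> Q' \<and> R P' Q')))"

definition ctx_bisim :: "('t,'c,'a) psi_ops \<Rightarrow> ('t,'c,'a) agent \<Rightarrow> ('t,'c,'a) agent \<Rightarrow> bool" where
  "ctx_bisim S P Q \<longleftrightarrow> (\<exists>R. is_ctx_bisimulation S R \<and> R P Q)"

end

theory Submission
  imports Defs
begin

text \<open>
  Putting an assertion \<open>\<Psi>\<close> next to \<open>P\<close> makes \<open>P\<close> move in the environment \<open>\<Psi> \<otimes> \<one>\<close> without adding
  transitions, so \<open>P\<close> in environment \<open>\<Psi>\<close> corresponds to \<open>\<Psi>\<^sub>1 | (\<dots> | (\<Psi>\<^sub>n | P))\<close> in the unit
  environment whenever \<open>\<Psi> \<simeq> \<Psi>\<^sub>1 \<otimes> \<dots> \<otimes> \<Psi>\<^sub>n\<close>; either bisimilarity yields a bisimulation of the other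
  kind through this correspondence.  The point that needs work is that transitions depend on the
  environment only up to \<open>\<simeq>\<close>: equivalent assertions may have different support, so the bound names
  in a derivation have to be renamed away from the new one.
\<close>

section \<open>Permutations of names\<close>

text \<open>The two notions guard the bound names of an action differently: a bisimulation asks them
  to avoid the support of \<open>\<Psi>\<close>, a context bisimulation the supports of all
  assertions standing in parallel. Equivalent assertions need not share their supports, so neither
  condition gives the other. A step is therefore matched after renaming its bound names away from
  everything, and the answer is renamed back; this is why both bisimilarities have to be
  equivariant. Renaming back also acts on the assertions whose support met the original bound names.
  These lie on one side only of the correspondence, and the candidate relations survive because they
  tie \<open>\<Psi>\<close> to the list of assertions merely up to equivalence. Agents are raw
  syntax with explicit alpha-equivalence, so much of the work consists in showing that a permutation
  matters only through its values on free names.\<close>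

lemma permN_eq_permBy: "permN = permBy swapN"
  by (simp add: permN_def permBy_def fun_eq_iff)

lemma permBy_Nil [simp]: "permBy sw [] x = x"
  by (simp add: permBy_def)

lemma permBy_Cons [simp]: "permBy sw ((a, b) # p) x = sw a b (permBy sw p x)"
  by (simp add: permBy_def)

lemma permBy_append: "permBy sw (p @ q) x = permBy sw p (permBy sw q x)"
  by (simp add: permBy_def)

lemma permBy_rev:
  assumes "\<And>a b x. sw a b (sw a b x) = x"
  shows "permBy sw (rev p) (permBy sw p x) = x"
  by (induction p arbitrary: x) (auto simp: permBy_append assms)

lemma swapN_swapN [simp]: "swapN a b (swapN a b c) = c"
  by (auto simp: swapN_def)

lemma permN_Nil [simp]: "permN [] x = x"
  by (simp add: permN_eq_permBy)

lemma permN_Nil_fun [simp]: "permN [] = (\<lambda>x. x)"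
  by (simp add: fun_eq_iff)

lemma permN_Cons [simp]: "permN ((a, b) # p) x = swapN a b (permN p x)"
  by (simp add: permN_eq_permBy)

lemma permN_append [simp]: "permN (p @ q) x = permN p (permN q x)"
  by (simp add: permN_eq_permBy permBy_append)

lemma permN_rev [simp]: "permN (rev p) (permN p x) = x"
  by (simp add: permN_eq_permBy permBy_rev)

lemma permN_rev' [simp]: "permN p (permN (rev p) x) = x"
  using permN_rev[of "rev p" x] by simp

lemma permN_eq_iff [simp]: "permN p x = permN p y \<longleftrightarrow> x = y"
  by (metis permN_rev)

lemma inj_permN: "inj (permN p)"
  by (simp add: inj_def)

lemma image_permN_Diff [simp]: "permN p ` (A - B) = permN p ` A - permN p ` B"
  by (simp add: image_set_diff inj_permN)

lemma image_permN_Int: "permN p ` A \<inter> permN p ` B = permN p ` (A \<inter> B)"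
  by (simp add: image_Int inj_permN)

lemma image_permN_disjoint [simp]: "permN p ` A \<inter> permN p ` B = {} \<longleftrightarrow> A \<inter> B = {}"
  by (simp add: image_permN_Int)

lemma image_permN_mem [simp]: "permN p x \<in> permN p ` A \<longleftrightarrow> x \<in> A"
  by (auto)

lemma fixes_image: "fixes_names p A \<Longrightarrow> permN p ` A = A"
  by (force simp: fixes_names_def)

lemma fixes_rev: "fixes_names p A \<Longrightarrow> fixes_names (rev p) A"
  unfolding fixes_names_def by (metis permN_rev)

lemma fixes_append: "fixes_names p A \<Longrightarrow> fixes_names q A \<Longrightarrow> fixes_names (p @ q) A"
  by (simp add: fixes_names_def)

lemma fixes_conj: "fixes_names q A \<Longrightarrow> fixes_names (p @ q @ rev p) (permN p ` A)"
  by (simp add: fixes_names_def)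

text \<open>Induction on \<open>A\<close>: after renaming \<open>A\<close>, the next name is swapped
  with a name fresh for everything so far. The second conclusion limits the effect: only names of
  \<open>A\<close> and their new images are moved.\<close>

lemma fresh_renaming:
  assumes "finite A" "finite X"
  obtains q where "permN q ` A \<inter> X = {}" "\<And>x. x \<notin> A \<Longrightarrow> x \<notin> permN q ` A \<Longrightarrow> permN q x = x"
proof -
  have "\<exists>q. permN q ` A \<inter> X = {} \<and> (\<forall>x. x \<notin> A \<longrightarrow> x \<notin> permN q ` A \<longrightarrow> permN q x = x)"
    using assms
  proof (induction A arbitrary: X rule: finite_induct)
    case empty
    then show ?case by (intro exI[of _ "[]"]) simp
  next
    case (insert a A)
    \<comment> \<open>Asking the images to avoid \<open>a\<close> as well leaves \<open>a\<close>
      untouched by \<open>q\<close>, so that the new swapping alone renames it.\<close>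
    then obtain q where q: "permN q ` A \<inter> insert a X = {}"
      "\<forall>x. x \<notin> A \<longrightarrow> x \<notin> permN q ` A \<longrightarrow> permN q x = x"
      by (metis finite_insert)
    have "finite (insert a (X \<union> A \<union> permN q ` A))" using insert by simp
    then obtain c where c: "c \<notin> insert a (X \<union> A \<union> permN q ` A)"
      by (metis ex_new_if_finite infinite_UNIV_nat)
    have a: "permN q a = a" using q insert by auto
    have A: "permN ((a, c) # q) y = permN q y" if "y \<in> A" for y
      using that q(1) c by (auto simp: swapN_def)
    have "permN ((a, c) # q) ` A = permN q ` A" using A by (rule image_cong[OF refl])
    then have img: "permN ((a, c) # q) ` insert a A = insert c (permN q ` A)"
      using a by (simp add: swapN_def)
    show ?case
    proof (intro exI[of _ "(a, c) # q"] conjI allI impI)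
      show "permN ((a, c) # q) ` insert a A \<inter> X = {}"
        unfolding img using q(1) c by auto
    next
      fix x assume "x \<notin> insert a A" "x \<notin> permN ((a, c) # q) ` insert a A"
      then show "permN ((a, c) # q) x = x"
        unfolding img using q(2) by (simp add: swapN_def)
    qed
  qed
  then show ?thesis using that by blast
qed

lemma fresh_renaming_fixing:
  assumes "finite A" "finite X"
  obtains q where "permN q ` A \<inter> X = {}" "\<And>x. x \<in> X \<Longrightarrow> x \<notin> A \<Longrightarrow> permN q x = x"
    "\<And>x. A = {} \<Longrightarrow> permN q x = x"
proof -
  obtain q where q: "permN q ` A \<inter> X = {}" "\<And>x. x \<notin> A \<Longrightarrow> x \<notin> permN q ` A \<Longrightarrow> permN q x = x"
    using fresh_renaming[OF assms] by blast
  show ?thesis by (rule that[of q]) (use q in blast)+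
qed

lemma permN_append_fun: "permN (p @ q) = (\<lambda>x. permN p (permN q x))"
  by (simp add: fun_eq_iff)

section \<open>Nominal sets\<close>

text \<open>Eliminating the names of a product of swappings one at a time in this way shows that it acts
  trivially on every element whose support it fixes.\<close>
lemma permBy_isolate_name:
  assumes "nominal_set sw"
  shows "\<exists>q. permN p = permN ((a, permN p a) # q) \<and> (\<forall>x. permBy sw p x = permBy sw ((a, permN p a) # q) x) \<and>
    fst ` set q \<union> snd ` set q \<subseteq> (fst ` set p \<union> snd ` set p) - {a}"
proof -
  have aa: "sw a a x = x" and inv: "sw a b (sw a b x) = x"
    and conj: "sw a b (sw c d x) = sw (swapN a b c) (swapN a b d) (sw a b x)" for a b c d x
    using assms by (auto simp: nominal_set_def)
  \<comment> \<open>Symmetry is not among the axioms; it comes from conjugating the swapping of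
    \<open>a\<close> and \<open>b\<close> by itself, which exchanges its two arguments.\<close>
  have comm: "sw a b x = sw b a x" for a b x
  proof -
    have "sw a b (sw a b (sw a b x)) = sw b a (sw a b (sw a b x))"
      using conj[of a b a b "sw a b x"] by (simp add: swapN_def split: if_splits)
    then show ?thesis by (simp only: inv)
  qed
  show ?thesis
  proof (induction p)
    case Nil
    show ?case by (intro exI[of _ "[]"]) (auto simp: aa swapN_def fun_eq_iff)
  next
    case (Cons de p)
    obtain d e where de: "de = (d, e)" by (cases de)
    obtain q where q: "permN p = permN ((a, permN p a) # q)"
      "\<And>x. permBy sw p x = permBy sw ((a, permN p a) # q) x"
      "fst ` set q \<union> snd ` set q \<subseteq> (fst ` set p \<union> snd ` set p) - {a}"
      using Cons by blast
    define c where "c = permN p a"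
    have pN: "permN p x = swapN a c (permN q x)" for x
      unfolding c_def by (subst q(1)) (rule permN_Cons)
    have pS: "permBy sw p x = sw a c (permBy sw q x)" for x
      unfolding c_def by (subst q(2)) (rule permBy_Cons)
    \<comment> \<open>A name that does not occur in \<open>p\<close> is fixed by it, so by
      injectivity it is not the image of another name. This keeps the names of the remaining product
      within those of \<open>p\<close>.\<close>
    have cp: "c \<in> fst ` set p \<union> snd ` set p" if "c \<noteq> a"
    proof (rule ccontr)
      have fix_absent: "permN p b = b" if "b \<notin> fst ` set p \<union> snd ` set p" for p b
        using that by (induction p) (auto simp: swapN_def)
      assume "c \<notin> fst ` set p \<union> snd ` set p"
      then have "permN p c = permN p a" using fix_absent[of c p] by (simp add: c_def)
      then show False using that by simp
    qed
    define C where "C = swapN d e c"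
    have top: "permN (de # p) a = C" unfolding de c_def C_def by simp
    \<comment> \<open>It suffices to find a product \<open>r\<close> avoiding \<open>a\<close> such
      that (d e)(a c) followed by \<open>q\<close> equals (a C) followed by \<open>r\<close>, both
      on names and on elements.\<close>
    have *: ?case
      if "\<And>y. swapN d e (swapN a c (permN q y)) = swapN a C (permN r y)"
        and "\<And>x. sw d e (sw a c (permBy sw q x)) = sw a C (permBy sw r x)"
        and "fst ` set r \<union> snd ` set r \<subseteq> fst ` set (de # p) \<union> snd ` set (de # p) - {a}" for r
      unfolding top using that by (intro exI[of _ r]) (simp add: de pN pS fun_eq_iff)
    consider (1) "d = e" | (2) "d \<noteq> e" "d \<noteq> a" "e \<noteq> a" | (3) "d \<noteq> e" "d = a \<or> e = a" by blast
    then show ?case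
    proof cases
      case 1
      then have "C = c" "\<And>x. swapN d e x = x" "\<And>x. sw d e x = x"
        by (auto simp: C_def swapN_def aa)
      then show ?thesis using q(3) by (intro *[of q]) auto
    next
      case 2
      \<comment> \<open>This swapping leaves \<open>a\<close> alone, so conjugation moves it behind
        the leading one and turns \<open>c\<close> into \<open>C\<close>.\<close>
      then have "swapN d e a = a" by (simp add: swapN_def)
      then have "sw d e (sw a c x) = sw a C (sw d e x)" for x
        using conj[of d e a c x] by (simp add: C_def)
      moreover have "swapN d e (swapN a c x) = swapN a C (swapN d e x)" for x
        using 2 by (auto simp: C_def swapN_def)
      ultimately show ?thesis using q(3) 2 by (intro *[of "(d, e) # q"]) (auto simp: de)
    next
      case 3
      define f where "f = (if d = a then e else d)"
      have f: "f \<noteq> a" "\<And>x. sw d e x = sw a f x" "\<And>x. swapN d e x = swapN a f x"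
        using 3 comm[of e d] by (auto simp: f_def swapN_def)
      have fm: "f \<in> fst ` set (de # p) \<union> snd ` set (de # p)"
        by (auto simp: f_def de)
      consider (a) "c = a" | (f) "c = f" "c \<noteq> a" | (o) "c \<noteq> a" "c \<noteq> f" by blast
      then show ?thesis
      proof cases
        case a
        then have "C = f" using f by (auto simp: C_def swapN_def)
        moreover have "swapN a c y = y" for y using a by (simp add: swapN_def)
        ultimately show ?thesis using q(3) f a by (intro *[of q]) (auto simp: aa)
      next
        case f': f
        then have "C = a" using f by (auto simp: C_def swapN_def)
        moreover have "swapN a a y = y" for y by (simp add: swapN_def)
        ultimately show ?thesis using q(3) f f' by (intro *[of q]) (auto simp: aa inv)
      next
        case o
        \<comment> \<open>The identity (a f)(a c) = (a c)(c f) keeps \<open>a\<close> in the leading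
          swapping only.\<close>
        have "sw a f (sw a c x) = sw a c (sw c f x)" for x
          using conj[of a c c f x] o f(1) by (simp add: swapN_def)
        moreover have "swapN a f (swapN a c x) = swapN a c (swapN c f x)" for x
          using o f(1) by (auto simp: swapN_def)
        moreover have "C = c" using o f by (simp add: C_def swapN_def)
        ultimately show ?thesis using q(3) f fm cp o by (intro *[of "(c, f) # q"]) auto
      qed
    qed
  qed
qed

text \<open>For almost every name \<open>c\<close>, the swappings of \<open>a\<close> with
  \<open>c\<close> and of \<open>b\<close> with \<open>c\<close> both fix \<open>x\<close>.
  Conjugating the first by the second gives the swapping of \<open>a\<close> and
  \<open>b\<close>.\<close>

lemma swap_fresh:
  assumes "nominal_set sw" "a \<notin> supp_of sw x" "b \<notin> supp_of sw x"
  shows "sw a b x = x"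
proof (cases "a = b")
  case True
  then show ?thesis using assms by (simp add: nominal_set_def)
next
  case False
  have "finite ({c. sw a c x \<noteq> x} \<union> {c. sw b c x \<noteq> x} \<union> {a, b})"
    using assms by (simp add: supp_of_def)
  then obtain c where c: "c \<notin> {c. sw a c x \<noteq> x} \<union> {c. sw b c x \<noteq> x} \<union> {a, b}"
    using ex_new_if_finite[OF infinite_UNIV_nat] by metis
  have "sw b c (sw a c x) = sw (swapN b c a) (swapN b c c) (sw b c x)"
    using assms(1) by (simp add: nominal_set_def)
  then show ?thesis using c False by (simp add: swapN_def)
qed

text \<open>The induction is on the number of names occurring in \<open>p\<close>: isolating
  \<open>a\<close> removes that name from the rest. The leading swapping exchanges \<open>a\<close>
  with its image; these coincide as soon as one of them lies in the support, and otherwise both are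
  fresh.\<close>

lemma permBy_fixes:
  assumes nom: "nominal_set sw"
  shows "fixes_names p (supp_of sw x) \<Longrightarrow> permBy sw p x = x"
proof (induction "card (fst ` set p \<union> snd ` set p)" arbitrary: p rule: less_induct)
  case less
  show ?case
  proof (cases p)
    case Nil
    then show ?thesis by simp
  next
    case (Cons ab p0)
    define a where "a = fst ab"
    define c where "c = permN p a"
    obtain q where q: "permN p = permN ((a, c) # q)" "permBy sw p x = sw a c (permBy sw q x)"
      "fst ` set q \<union> snd ` set q \<subseteq> (fst ` set p \<union> snd ` set p) - {a}"
      using permBy_isolate_name[OF nom, of p a] unfolding c_def permBy_Cons by blast
    have smaller: "card (fst ` set q \<union> snd ` set q) < card (fst ` set p \<union> snd ` set p)"
    proof (rule psubset_card_mono)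
      have "a \<in> fst ` set p \<union> snd ` set p" using Cons by (simp add: a_def)
      then show "fst ` set q \<union> snd ` set q \<subset> fst ` set p \<union> snd ` set p" using q(3) by blast
    qed simp
    have qN: "permN q y = swapN a c (permN p y)" for y using q(1) by simp
    have px: "permN p y = y" if "y \<in> supp_of sw x" for y
      using less(2) that by (simp add: fixes_names_def)
    have eq: "a = c" if "a \<in> supp_of sw x \<or> c \<in> supp_of sw x"
      using that px[of a] px[of c] unfolding c_def by auto
    have swx: "sw a c x = x"
    proof (cases "a = c")
      case True
      then show ?thesis using nom by (simp add: nominal_set_def)
    next
      case False
      then show ?thesis using swap_fresh[OF nom] eq by blast
    qed
    have "swapN a c y = y" if "y \<in> supp_of sw x" for y
      using that eq by (cases "a = c") (auto simp: swapN_def)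
    then have "fixes_names q (supp_of sw x)"
      using px by (simp add: fixes_names_def qN)
    then show ?thesis using less(1)[OF smaller] q(2) swx by simp
  qed
qed

text \<open>Conjugation turns a swapping of two names on the swapped element into a swapping of
  their images on \<open>x\<close>, and the injection \<open>swapN a b\<close> preserves finiteness
  of the set of names moved.\<close>

lemma supp_of_swap:
  assumes nom: "nominal_set sw"
  shows "supp_of sw (sw a b x) = swapN a b ` supp_of sw x"
proof -
  have inv: "sw a b (sw a b x) = x"
    and conj: "sw a b (sw c d x) = sw (swapN a b c) (swapN a b d) (sw a b x)" for a b c d x
    using nom by (auto simp: nominal_set_def)
  have image: "A = swapN a b ` B" if "\<And>d. swapN a b d \<in> A \<longleftrightarrow> d \<in> B" for A B
  proof (intro set_eqI iffI)
    fix d assume "d \<in> A"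
    then have "swapN a b d \<in> B" using that[of "swapN a b d"] by simp
    then show "d \<in> swapN a b ` B" by (intro image_eqI[of _ _ "swapN a b d"]) simp_all
  qed (use that in auto)
  have "{d. sw c d (sw a b x) \<noteq> sw a b x} = swapN a b ` {d. sw (swapN a b c) d x \<noteq> x}" for c
  proof -
    have "sw c (swapN a b d) (sw a b x) = sw a b (sw (swapN a b c) d x)" for d
      using conj[of a b "swapN a b c" d x] by simp
    then have "sw c (swapN a b d) (sw a b x) = sw a b x \<longleftrightarrow> sw (swapN a b c) d x = x" for d
      by (metis inv)
    then have "swapN a b d \<in> {d. sw c d (sw a b x) \<noteq> sw a b x} \<longleftrightarrow> d \<in> {d. sw (swapN a b c) d x \<noteq> x}" for d
      by simp
    then show ?thesis by (rule image)
  qed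
  moreover have "inj (swapN a b)" by (metis injI swapN_swapN)
  ultimately have "swapN a b c \<in> supp_of sw (sw a b x) \<longleftrightarrow> c \<in> supp_of sw x" for c
    by (simp add: supp_of_def finite_image_iff inj_on_subset)
  then show ?thesis by (rule image)
qed

lemma supp_of_permBy:
  assumes "nominal_set sw"
  shows "supp_of sw (permBy sw p x) = permN p ` supp_of sw x"
proof (induction p)
  case (Cons ab p)
  then show ?case by (cases ab) (simp add: supp_of_swap[OF assms] image_image)
qed simp

lemma permBy_rev_nominal [simp]:
  assumes "nominal_set sw"
  shows "permBy sw (rev p) (permBy sw p x) = x"
  using assms by (intro permBy_rev) (simp add: nominal_set_def)

text \<open>The product \<open>rev q @ p\<close> fixes the support of \<open>x\<close>
  pointwise.\<close>

lemma permBy_cong: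
  assumes "nominal_set sw" "\<And>a. a \<in> supp_of sw x \<Longrightarrow> permN p a = permN q a"
  shows "permBy sw p x = permBy sw q x"
proof -
  have "permBy sw (rev q @ p) x = x"
    using assms by (intro permBy_fixes) (auto simp: fixes_names_def)
  then show ?thesis
    using permBy_rev_nominal[OF assms(1), of "rev q" "permBy sw p x"] by (simp add: permBy_append)
qed

section \<open>Agents and alpha-equivalence\<close>

lemma finite_supp_of: "nominal_set sw \<Longrightarrow> finite (supp_of sw x)"
  by (simp add: nominal_set_def)

lemma permBy_Nil_fun [simp]: "permBy sw [] = (\<lambda>x. x)"
  by (simp add: fun_eq_iff)

text \<open>Since \<open>p\<close> fixes the free names pointwise and supports are equivariant, both
  sides have the same free names; alpha-variants of a frame are exactly its images under such
  permutations.\<close>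

lemma alphaF_iff:
  assumes "nominal_set (swA S)"
  shows "alphaF S (bs, \<Psi>) G \<longleftrightarrow>
    (\<exists>p. fixes_names p (suppA S \<Psi> - set bs) \<and> G = (map (permN p) bs, permBy (swA S) p \<Psi>))"
proof -
  have eq: "suppA S \<Psi> - set bs = suppA S (permBy (swA S) p \<Psi>) - permN p ` set bs"
    if "fixes_names p (suppA S \<Psi> - set bs)" for p
    using fixes_image[OF that] by (simp add: suppA_def supp_of_permBy[OF assms])
  obtain cs \<Psi>' where G: "G = (cs, \<Psi>')" by (cases G)
  show ?thesis
  proof
    assume "alphaF S (bs, \<Psi>) G"
    then obtain p where "fixes_names p (suppA S \<Psi> - set bs)" "map (permN p) bs = cs"
      "permBy (swA S) p \<Psi> = \<Psi>'"
      unfolding alphaF_def G by auto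
    then show "\<exists>p. fixes_names p (suppA S \<Psi> - set bs) \<and> G = (map (permN p) bs, permBy (swA S) p \<Psi>)"
      unfolding G by blast
  next
    assume "\<exists>p. fixes_names p (suppA S \<Psi> - set bs) \<and> G = (map (permN p) bs, permBy (swA S) p \<Psi>)"
    then obtain p where p: "fixes_names p (suppA S \<Psi> - set bs)" "cs = map (permN p) bs"
      "\<Psi>' = permBy (swA S) p \<Psi>"
      unfolding G by blast
    show "alphaF S (bs, \<Psi>) G"
      unfolding alphaF_def G prod.case p(2,3) set_map using p(1) eq[OF p(1)] by blast
  qed
qed

lemma alpha_PInE:
  assumes "alpha S (PIn M xs N P) R"
  obtains p P' where "R = PIn M (map (permN p) xs) (permBy (swT S) p N) P'"
    "fixes_names p ((suppT S N \<union> fnP S P) - set xs)" "alpha S (permP S p P) P'"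
  using assms
proof cases
  case (aIn N' P' ys p)
  then show ?thesis using that by metis
qed

lemma alpha_PResE:
  assumes "alpha S (PRes x P) R"
  obtains p P' where "R = PRes (permN p x) P'"
    "fixes_names p (fnP S P - {x})" "alpha S (permP S p P) P'"
  using assms
proof cases
  case (aRes P' y p)
  then show ?thesis using that by metis
qed

section \<open>The permutation action inside a fixed psi-calculus\<close>

locale psi =
  fixes S :: "('t,'c,'a) psi_ops"
  assumes psi_calculus: "psi_calculus S"
begin

abbreviation "pT \<equiv> permBy (swT S)"
abbreviation "pC \<equiv> permBy (swC S)"
abbreviation "pA \<equiv> permBy (swA S)"
abbreviation "pP \<equiv> permP S"

lemma nominal [simp]: "nominal_set (swT S)" "nominal_set (swC S)" "nominal_set (swA S)"
  using psi_calculus by (simp_all add: psi_calculus_def)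

lemma supp_perm [simp]:
  "suppT S (pT p M) = permN p ` suppT S M"
  "suppC S (pC p \<phi>) = permN p ` suppC S \<phi>"
  "suppA S (pA p \<Psi>) = permN p ` suppA S \<Psi>"
  by (simp_all add: suppT_def suppC_def suppA_def supp_of_permBy)

lemma finite_supp [simp]: "finite (suppT S M)" "finite (suppC S \<phi>)" "finite (suppA S \<Psi>)"
  by (simp_all add: suppT_def suppC_def suppA_def finite_supp_of)

lemma pT_cong: "(\<And>a. a \<in> suppT S M \<Longrightarrow> permN p a = permN q a) \<Longrightarrow> pT p M = pT q M"
  and pC_cong: "(\<And>a. a \<in> suppC S \<phi> \<Longrightarrow> permN p a = permN q a) \<Longrightarrow> pC p \<phi> = pC q \<phi>"
  and pA_cong: "(\<And>a. a \<in> suppA S \<Psi> \<Longrightarrow> permN p a = permN q a) \<Longrightarrow> pA p \<Psi> = pA q \<Psi>"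
  by (auto simp: suppT_def suppC_def suppA_def intro!: permBy_cong)

lemma pT_fixes: "fixes_names p (suppT S M) \<Longrightarrow> pT p M = M"
  and pC_fixes: "fixes_names p (suppC S \<phi>) \<Longrightarrow> pC p \<phi> = \<phi>"
  and pA_fixes: "fixes_names p (suppA S \<Psi>) \<Longrightarrow> pA p \<Psi> = \<Psi>"
  by (auto simp: suppT_def suppC_def suppA_def intro!: permBy_fixes)

lemma pT_rev [simp]: "pT (rev p) (pT p M) = M" "pT p (pT (rev p) M) = M"
  using permBy_rev_nominal[of "swT S" p] permBy_rev_nominal[of "swT S" "rev p"] by simp_all

lemma pA_rev [simp]: "pA (rev p) (pA p \<Psi>) = \<Psi>" "pA p (pA (rev p) \<Psi>) = \<Psi>"
  using permBy_rev_nominal[of "swA S" p] permBy_rev_nominal[of "swA S" "rev p"] by simp_all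

lemma pC_rev [simp]: "pC (rev p) (pC p \<phi>) = \<phi>" "pC p (pC (rev p) \<phi>) = \<phi>"
  using permBy_rev_nominal[of "swC S" p] permBy_rev_nominal[of "swC S" "rev p"] by simp_all

lemma swap_ops:
  "swC S a b (chEq S M N) = chEq S (swT S a b M) (swT S a b N)"
  "swA S a b (comp S \<Psi> \<Psi>') = comp S (swA S a b \<Psi>) (swA S a b \<Psi>')"
  "swA S a b (unitA S) = unitA S"
  "ent S \<Psi> \<phi> \<Longrightarrow> ent S (swA S a b \<Psi>) (swC S a b \<phi>)"
  using psi_calculus unfolding psi_calculus_def by meson+

lemma swap_subst:
  "swT S a b (substT S M xs Ls) = substT S (swT S a b M) (map (swapN a b) xs) (map (swT S a b) Ls)"
  "swC S a b (substC S \<phi> xs Ls) = substC S (swC S a b \<phi>) (map (swapN a b) xs) (map (swT S a b) Ls)"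
  "swA S a b (substA S \<Psi> xs Ls) = substA S (swA S a b \<Psi>) (map (swapN a b) xs) (map (swT S a b) Ls)"
  using psi_calculus unfolding psi_calculus_def subst_axioms_def by meson+

lemma chEq_perm: "pC p (chEq S M N) = chEq S (pT p M) (pT p N)"
  by (induction p) (auto simp: swap_ops)

lemma comp_perm [simp]: "pA p (comp S \<Psi> \<Psi>') = comp S (pA p \<Psi>) (pA p \<Psi>')"
  by (induction p) (auto simp: swap_ops)

lemma unit_perm [simp]: "pA p (unitA S) = unitA S"
  by (induction p) (auto simp: swap_ops)

lemma ent_permI: "ent S \<Psi> \<phi> \<Longrightarrow> ent S (pA p \<Psi>) (pC p \<phi>)"
  by (induction p) (auto simp: swap_ops(4))

lemma ent_perm [simp]: "ent S (pA p \<Psi>) (pC p \<phi>) \<longleftrightarrow> ent S \<Psi> \<phi>"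
  using ent_permI[of \<Psi> \<phi> p] ent_permI[of "pA p \<Psi>" "pC p \<phi>" "rev p"] by auto

lemma subst_perm:
  "pT p (substT S M xs Ls) = substT S (pT p M) (map (permN p) xs) (map (pT p) Ls)"
  "pC p (substC S \<phi> xs Ls) = substC S (pC p \<phi>) (map (permN p) xs) (map (pT p) Ls)"
  "pA p (substA S \<Psi> xs Ls) = substA S (pA p \<Psi>) (map (permN p) xs) (map (pT p) Ls)"
proof -
  have "permN ((a, b) # p) = swapN a b \<circ> permN p" "pT ((a, b) # p) = swT S a b \<circ> pT p" for a b p
    by (simp_all add: fun_eq_iff)
  note fold = this
  show "pT p (substT S M xs Ls) = substT S (pT p M) (map (permN p) xs) (map (pT p) Ls)"
    "pC p (substC S \<phi> xs Ls) = substC S (pC p \<phi>) (map (permN p) xs) (map (pT p) Ls)"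
    "pA p (substA S \<Psi> xs Ls) = substA S (pA p \<Psi>) (map (permN p) xs) (map (pT p) Ls)"
    by (induction p) (auto simp: swap_subst fold)
qed

text \<open>If \<open>a\<close> is fresh for both arguments, almost all swappings of
  \<open>a\<close> fix both of them, hence by equivariance also the composition.\<close>

lemma supp_comp: "suppA S (comp S \<Psi> \<Psi>') \<subseteq> suppA S \<Psi> \<union> suppA S \<Psi>'"
proof (rule subsetI, rule ccontr)
  fix a assume *: "a \<in> suppA S (comp S \<Psi> \<Psi>')" and "a \<notin> suppA S \<Psi> \<union> suppA S \<Psi>'"
  then have "finite ({b. swA S a b \<Psi> \<noteq> \<Psi>} \<union> {b. swA S a b \<Psi>' \<noteq> \<Psi>'})"
    by (simp add: suppA_def supp_of_def)
  then have "finite {b. swA S a b (comp S \<Psi> \<Psi>') \<noteq> comp S \<Psi> \<Psi>'}"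
    by (rule rev_finite_subset) (auto simp: swap_ops(2))
  then show False using * by (simp add: suppA_def supp_of_def)
qed

lemma assert_eq_refl [simp]: "assert_eq S \<Psi> \<Psi>"
  and assert_eq_sym: "assert_eq S \<Psi> \<Psi>' \<Longrightarrow> assert_eq S \<Psi>' \<Psi>"
  and assert_eq_trans: "assert_eq S \<Psi> \<Psi>' \<Longrightarrow> assert_eq S \<Psi>' \<Psi>'' \<Longrightarrow> assert_eq S \<Psi> \<Psi>''"
  by (auto simp: assert_eq_def)

lemma comp_comm: "assert_eq S (comp S \<Psi> \<Psi>') (comp S \<Psi>' \<Psi>)"
  and comp_assoc: "assert_eq S (comp S (comp S \<Psi> \<Psi>') \<Psi>'') (comp S \<Psi> (comp S \<Psi>' \<Psi>''))"
  and comp_unit: "assert_eq S (comp S \<Psi> (unitA S)) \<Psi>"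
  and comp_cong1: "assert_eq S \<Psi> \<Psi>' \<Longrightarrow> assert_eq S (comp S \<Psi> \<Psi>'') (comp S \<Psi>' \<Psi>'')"
  using psi_calculus unfolding psi_calculus_def by meson+

lemma comp_cong2: "assert_eq S \<Psi> \<Psi>' \<Longrightarrow> assert_eq S (comp S \<Psi>'' \<Psi>) (comp S \<Psi>'' \<Psi>')"
  by (meson assert_eq_trans comp_comm comp_cong1)

lemma assert_eq_perm: "assert_eq S \<Psi> \<Psi>' \<Longrightarrow> assert_eq S (pA p \<Psi>) (pA p \<Psi>')"
  unfolding assert_eq_def by (metis ent_perm pC_rev(2))

lemma pP_simps [simp]:
  "pP p PNil = PNil"
  "pP p (POut M N P) = POut (pT p M) (pT p N) (pP p P)"
  "pP p (PIn M xs N P) = PIn (pT p M) (map (permN p) xs) (pT p N) (pP p P)"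
  "pP p (PCase cs) = PCase (map (map_prod (pC p) (pP p)) cs)"
  "pP p (PRes x P) = PRes (permN p x) (pP p P)"
  "pP p (PPar P Q) = PPar (pP p P) (pP p Q)"
  "pP p (PBang P) = PBang (pP p P)"
  "pP p (PAssert \<Psi>) = PAssert (pA p \<Psi>)"
  by (induction p; force simp: permP_def o_def map_idI)+

lemma pP_Nil [simp]: "pP [] P = P"
  by (simp add: permP_def)

lemma pP_append: "pP (p @ q) P = pP p (pP q P)"
  by (simp add: permP_def permBy_append)

lemma pP_rev [simp]: "pP (rev p) (pP p P) = P" "pP p (pP (rev p) P) = P"
proof -
  have "swP S a b (swP S a b P) = P" for a b P
  proof (induction P)
    case (PCase cs)
    then show ?case using nominal by (auto simp: nominal_set_def o_def intro!: map_idI)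
  qed (use nominal in \<open>auto simp: nominal_set_def o_def map_idI\<close>)
  then have "pP (rev p) (pP p P) = P" for p P
    unfolding permP_def by (intro permBy_rev)
  from this[of p] this[of "rev p"] show "pP (rev p) (pP p P) = P" "pP p (pP (rev p) P) = P"
    by simp_all
qed

lemma fnP_PCase: "fnP S (PCase cs) = (\<Union>c\<in>set cs. suppC S (fst c) \<union> fnP S (snd c))"
  by (simp add: image_image case_prod_unfold)

lemma bnP_PCase: "bnP (PCase cs) = (\<Union>c\<in>set cs. bnP (snd c))"
  by (simp add: image_image case_prod_unfold)

lemma fnP_perm [simp]: "fnP S (pP p P) = permN p ` fnP S P"
proof (induction P)
  case (PCase cs)
  have "permN p ` (suppC S (fst c) \<union> fnP S (snd c)) = suppC S (pC p (fst c)) \<union> fnP S (pP p (snd c))"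
    if "c \<in> set cs" for c
    using PCase[OF that, of "snd c"] by (simp add: image_Un snds.simps prod_eq_iff)
  then show ?case
    unfolding pP_simps fnP_PCase image_UN set_map by (simp add: image_UN)
qed (simp_all add: image_Un)

lemma finite_fnP [simp]: "finite (fnP S P)"
  by (induction P) auto

lemma bnP_perm [simp]: "bnP (pP p P) = permN p ` bnP P"
proof (induction P)
  case (PCase cs)
  have "permN p ` bnP (snd c) = bnP (pP p (snd c))" if "c \<in> set cs" for c
    using PCase[OF that, of "snd c"] by (simp add: snds.simps prod_eq_iff)
  then show ?case
    unfolding pP_simps bnP_PCase image_UN set_map by (simp add: image_UN)
qed (simp_all add: image_Un)

lemma rsubst_perm:
  "pP p (rsubst S P ys Ls) = rsubst S (pP p P) (map (permN p) ys) (map (pT p) Ls)"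
  by (induction P) (auto simp: subst_perm)

lemma alpha_fnP: "alpha S P Q \<Longrightarrow> fnP S P = fnP S Q"
proof (induction rule: alpha.induct)
  case (aCase cs cs')
  then have "map (map_prod (suppC S) (fnP S)) cs = map (map_prod (suppC S) (fnP S)) cs'"
    by (induction rule: list_all2_induct) (auto simp: rel_prod_sel prod_eq_iff)
  then show ?case by simp
qed auto

text \<open>The equality of free names in rule \<open>aIn\<close> follows from
  \<open>alpha_fnP\<close> for the bodies, because \<open>p\<close> maps the free names onto
  themselves.\<close>

lemma alpha_InI:
  assumes fixed: "fixes_names p ((suppT S N \<union> fnP S P) - set xs)"
    and "ys = map (permN p) xs" "N' = pT p N" and alpha: "alpha S (pP p P) P'"
  shows "alpha S (PIn M xs N P) (PIn M ys N' P')"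
  unfolding assms(2,3)
proof (rule aIn[OF _ fixed refl refl alpha])
  have "(suppT S N \<union> fnP S P) - set xs = permN p ` ((suppT S N \<union> fnP S P) - set xs)"
    using fixes_image[OF fixed] by simp
  also have "\<dots> = (suppT S (pT p N) \<union> fnP S P') - set (map (permN p) xs)"
    using alpha_fnP[OF alpha] by (simp add: image_Un)
  finally show "(suppT S N \<union> fnP S P) - set xs = \<dots>" .
qed

lemma alpha_ResI:
  assumes fixed: "fixes_names p (fnP S P - {x})"
    and "y = permN p x" and alpha: "alpha S (pP p P) P'"
  shows "alpha S (PRes x P) (PRes y P')"
proof (rule aRes[OF _ fixed assms(2)[symmetric] alpha])
  have "fnP S P - {x} = permN p ` (fnP S P - {x})"
    using fixes_image[OF fixed] by simp
  also have "\<dots> = fnP S P' - {y}"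
    using alpha_fnP[OF alpha] assms(2) by simp
  finally show "fnP S P - {x} = \<dots>" .
qed

lemma alpha_refl [simp]: "alpha S P P"
proof (induction P)
  case (PIn M xs N P)
  then show ?case by (intro alpha_InI[where p="[]"]) (auto simp: fixes_names_def)
next
  case (PRes x P)
  then show ?case by (intro alpha_ResI[where p="[]"]) (auto simp: fixes_names_def)
next
  case (PCase cs)
  then show ?case by (intro aCase list.rel_refl_strong) (auto simp: rel_prod_sel)
qed (auto intro: alpha.intros)

text \<open>The permutations may disagree on bound names. At a binder the witness
  \<open>q @ rev p\<close> carries one body exactly onto the other and fixes what is free, so
  reflexivity closes these cases.\<close>

lemma alpha_perm_cong:
  assumes "\<And>a. a \<in> fnP S P \<Longrightarrow> permN p a = permN q a"
  shows "alpha S (pP p P) (pP q P)"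
  using assms
proof (induction P)
  case (PIn M xs N P)
  have "fixes_names (q @ rev p) (permN p ` ((suppT S N \<union> fnP S P) - set xs))"
    using PIn.prems[symmetric] by (auto simp: fixes_names_def)
  moreover have "pT p M = pT q M"
    using PIn.prems by (intro pT_cong) simp
  ultimately show ?case
    by (auto intro!: alpha_InI[where p="q @ rev p"]
      simp: image_Un pP_append permBy_append o_def)
next
  case (PRes x P)
  have "permN q a = permN p a" if "a \<in> fnP S P - {x}" for a
    using PRes.prems[of a] that by simp
  then have "fixes_names (q @ rev p) (permN p ` (fnP S P - {x}))"
    unfolding fixes_names_def ball_simps by simp
  then show ?case
    by (auto intro!: alpha_ResI[where p="q @ rev p"] simp: pP_append)
next
  case (PCase cs)
  have "rel_prod (=) (alpha S) (map_prod (pC p) (pP p) c) (map_prod (pC q) (pP q) c)"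
    if "c \<in> set cs" for c
  proof (cases c)
    case (Pair \<phi> P)
    have "suppC S \<phi> \<union> fnP S P \<subseteq> fnP S (PCase cs)" using that Pair by force
    then have "\<And>a. a \<in> suppC S \<phi> \<union> fnP S P \<Longrightarrow> permN p a = permN q a"
      using PCase.prems by blast
    then show ?thesis
      using PCase.IH[OF that, of P] Pair by (auto intro!: pC_cong)
  qed
  then show ?case
    by (simp add: aCase list_all2_map1 list_all2_map2 list.rel_refl_strong)
next
  case (POut M N P)
  then have "pT p M = pT q M" "pT p N = pT q N" by (auto intro!: pT_cong)
  then show ?case using POut by (auto intro: aOut)
next
  case (PAssert \<Psi>)
  then have "pA p \<Psi> = pA q \<Psi>" by (auto intro!: pA_cong)
  then show ?case by (auto intro: aAssert)
qed (auto intro!: alpha.intros)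

text \<open>At a binder the new witness is the conjugate of the old one by \<open>p\<close>.\<close>

lemma alpha_perm: "alpha S P Q \<Longrightarrow> alpha S (pP p P) (pP p Q)"
proof (induction rule: alpha.induct)
  case (aIn N P xs N' P' ys q M)
  let ?q = "p @ q @ rev p"
  have "fixes_names ?q (permN p ` ((suppT S N \<union> fnP S P) - set xs))"
    using aIn by (intro fixes_conj) simp
  then have "fixes_names ?q ((suppT S (pT p N) \<union> fnP S (pP p P)) - set (map (permN p) xs))"
    by (simp add: image_Un)
  then show ?case unfolding pP_simps
    by (rule alpha_InI)
      (use aIn in \<open>auto simp: pP_append permBy_append\<close>)
next
  case (aRes P x P' y q)
  let ?q = "p @ q @ rev p"
  have "fixes_names ?q (permN p ` (fnP S P - {x}))"
    using aRes by (intro fixes_conj) simp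
  then have "fixes_names ?q (fnP S (pP p P) - {permN p x})"
    by simp
  then show ?case unfolding pP_simps
    by (rule alpha_ResI) (use aRes in \<open>auto simp: pP_append\<close>)
next
  case (aCase cs cs')
  then show ?case
    by (auto intro!: alpha.aCase simp: list_all2_map1 list_all2_map2 rel_prod_sel elim!: list_all2_mono)
qed (auto intro: alpha.intros)

lemma alpha_trans: "alpha S P Q \<Longrightarrow> alpha S Q R \<Longrightarrow> alpha S P R"
proof (induction arbitrary: R rule: alpha.induct)
  case (aOut P P' M N)
  from aOut.prems show ?case by cases (auto intro: alpha.aOut aOut.IH)
next
  case (aIn N P xs N' P' ys p M)
  from \<open>alpha S (PIn M ys N' P') R\<close> obtain q P''
    where q: "R = PIn M (map (permN q) ys) (pT q N') P''"
      "fixes_names q ((suppT S N' \<union> fnP S P') - set ys)" "alpha S (pP q P') P''"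
    by (rule alpha_PInE)
  \<comment> \<open>The induction hypothesis needs an equivalence starting at \<open>P'\<close>, so
    \<open>q\<close> is moved to the other side first and moved back after composing.\<close>
  have "alpha S (pP p P) (pP (rev q) P'')"
    using aIn.IH alpha_perm[OF q(3), of "rev q"] by simp
  then have "alpha S (pP (q @ p) P) P''"
    using alpha_perm[of "pP p P" "pP (rev q) P''" q] by (simp add: pP_append)
  moreover have "fixes_names (q @ p) ((suppT S N \<union> fnP S P) - set xs)"
    using aIn(1,2) q(2) by (intro fixes_append) simp_all
  ultimately show ?case unfolding q(1) using aIn(3,4)
    by (intro alpha_InI[where p="q @ p"]) (auto simp: permBy_append)
next
  case (aRes P x P' y p)
  from \<open>alpha S (PRes y P') R\<close> obtain q P'' where q: "R = PRes (permN q y) P''"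
    "fixes_names q (fnP S P' - {y})" "alpha S (pP q P') P''"
    by (rule alpha_PResE)
  have "alpha S (pP p P) (pP (rev q) P'')"
    using aRes.IH alpha_perm[OF q(3), of "rev q"] by simp
  then have "alpha S (pP (q @ p) P) P''"
    using alpha_perm[of "pP p P" "pP (rev q) P''" q] by (simp add: pP_append)
  moreover have "fixes_names (q @ p) (fnP S P - {x})"
    using aRes(1,2) q(2) by (intro fixes_append) simp_all
  ultimately show ?case unfolding q(1) using aRes(3)
    by (intro alpha_ResI[where p="q @ p"]) auto
next
  case (aCase cs cs')
  from aCase(2) obtain cs'' where R: "R = PCase cs''" "list_all2 (rel_prod (=) (alpha S)) cs' cs''"
    by cases auto
  have "list_all2 (rel_prod (=) (alpha S)) cs cs''"
    by (rule list_all2_trans[OF _ aCase(1) R(2)]) (auto simp: rel_prod_sel)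
  then show ?case unfolding R(1) by (rule alpha.aCase)
next
  case (aPar P P' Q Q')
  from aPar.prems show ?case by cases (auto intro: alpha.aPar aPar.IH)
next
  case (aBang P P')
  from aBang.prems show ?case by cases (auto intro: alpha.aBang aBang.IH)
qed auto

section \<open>Frames\<close>

lemma alphaF_iff_perm:
  "alphaF S (bs, \<Psi>) G \<longleftrightarrow>
    (\<exists>p. fixes_names p (suppA S \<Psi> - set bs) \<and> G = (map (permN p) bs, pA p \<Psi>))"
  by (rule alphaF_iff) simp

lemma alphaF_permI:
  "fixes_names p (suppA S \<Psi> - set bs) \<Longrightarrow> alphaF S (bs, \<Psi>) (map (permN p) bs, pA p \<Psi>)"
  by (auto simp: alphaF_iff_perm)

lemma alphaF_refl [simp]: "alphaF S F F"
proof -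
  have "alphaF S (bs, \<Psi>) (map (permN []) bs, pA [] \<Psi>)" for bs \<Psi>
    by (rule alphaF_permI) (simp add: fixes_names_def)
  then show ?thesis by (cases F) simp
qed

lemma alphaF_trans:
  assumes "alphaF S F G" "alphaF S G H"
  shows "alphaF S F H"
proof -
  obtain bs \<Psi> where F: "F = (bs, \<Psi>)" by (cases F)
  obtain p where p: "fixes_names p (suppA S \<Psi> - set bs)" "G = (map (permN p) bs, pA p \<Psi>)"
    using assms(1) unfolding F alphaF_iff_perm by blast
  obtain q where q: "fixes_names q (suppA S (pA p \<Psi>) - set (map (permN p) bs))"
    "H = (map (permN q) (map (permN p) bs), pA q (pA p \<Psi>))"
    using assms(2) unfolding p(2) alphaF_iff_perm by blast
  have "fixes_names q (permN p ` (suppA S \<Psi> - set bs))"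
    using q(1) by simp
  then have "fixes_names (q @ p) (suppA S \<Psi> - set bs)"
    unfolding fixes_image[OF p(1)] using p(1) by (intro fixes_append)
  then show ?thesis
    unfolding F using alphaF_permI[of "q @ p" \<Psi> bs] q(2)
    by (simp add: permBy_append permN_append_fun o_def)
qed

lemma alphaF_sym:
  assumes "alphaF S F G"
  shows "alphaF S G F"
proof -
  obtain bs \<Psi> where F: "F = (bs, \<Psi>)" by (cases F)
  obtain p where p: "fixes_names p (suppA S \<Psi> - set bs)" "G = (map (permN p) bs, pA p \<Psi>)"
    using assms(1) unfolding F alphaF_iff_perm by blast
  have "fixes_names (rev p) (permN p ` (suppA S \<Psi> - set bs))"
    unfolding fixes_image[OF p(1)] by (rule fixes_rev[OF p(1)])
  then have "alphaF S G (map (permN (rev p)) (map (permN p) bs), pA (rev p) (pA p \<Psi>))"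
    unfolding p(2) by (intro alphaF_permI) simp
  then show ?thesis by (simp add: F o_def)
qed

lemma alphaF_perm:
  assumes "alphaF S F G"
  shows "alphaF S (map (permN p) (fst F), pA p (snd F)) (map (permN p) (fst G), pA p (snd G))"
proof -
  obtain bs \<Psi> where F: "F = (bs, \<Psi>)" by (cases F)
  obtain q where q: "fixes_names q (suppA S \<Psi> - set bs)" "G = (map (permN q) bs, pA q \<Psi>)"
    using assms(1) unfolding F alphaF_iff_perm by blast
  have "fixes_names (p @ q @ rev p) (permN p ` (suppA S \<Psi> - set bs))"
    using q(1) by (rule fixes_conj)
  then have "fixes_names (p @ q @ rev p) (suppA S (pA p \<Psi>) - set (map (permN p) bs))"
    by simp
  from alphaF_permI[OF this] show ?thesis
    by (simp add: F q(2) permBy_append o_def)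
qed

lemma isFrame_alphaF: "isFrame S P F \<Longrightarrow> alphaF S G F \<Longrightarrow> isFrame S P G"
  by (erule isFrame.cases; clarify) (blast intro: isFrame.intros alphaF_trans)+

lemma isFrame_perm: "isFrame S P F \<Longrightarrow> isFrame S (pP p P) (map (permN p) (fst F), pA p (snd F))"
proof (induction rule: isFrame.induct)
  case (fPar P b1 \<Psi>1 Q b2 \<Psi>2 F)
  let ?b1 = "map (permN p) b1" and ?b2 = "map (permN p) b2"
  show ?case unfolding pP_simps
  proof (rule isFrame.fPar)
    show "isFrame S (pP p P) (?b1, pA p \<Psi>1)" "isFrame S (pP p Q) (?b2, pA p \<Psi>2)"
      using fPar.IH by simp_all
    show "set ?b1 \<inter> (set ?b2 \<union> suppA S (pA p \<Psi>2)) = {}" "set ?b2 \<inter> (set ?b1 \<union> suppA S (pA p \<Psi>1)) = {}"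
      using fPar.hyps by (simp_all flip: image_Un)
    show "alphaF S (map (permN p) (fst F), pA p (snd F)) (?b1 @ ?b2, comp S (pA p \<Psi>1) (pA p \<Psi>2))"
      using alphaF_perm[OF fPar.hyps(5), of p] by simp
  qed
next
  case (fRes P bs \<Psi> F x)
  show ?case unfolding pP_simps
    by (rule isFrame.fRes) (use fRes.IH alphaF_perm[OF fRes.hyps(2), of p] in simp_all)
qed (auto intro!: isFrame.intros dest: alphaF_perm[of _ _ p])

lemma isFrame_rename:
  assumes "isFrame S P (bs, \<Psi>)" "fixes_names s (suppA S \<Psi> - set bs)"
  shows "isFrame S P (map (permN s) bs, pA s \<Psi>)"
  by (rule isFrame_alphaF[OF assms(1) alphaF_sym[OF alphaF_permI[OF assms(2)]]])

lemma frame_ent_alphaF: "alphaF S F G \<Longrightarrow> frame_ent S F \<phi> \<longleftrightarrow> frame_ent S G \<phi>"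
  unfolding frame_ent_def by (meson alphaF_sym alphaF_trans)

text \<open>The names are treated one at a time, swapping the current image of \<open>a\<close> with
  its target; injectivity keeps both apart from the images already settled. The lemma serves to
  replace a witness of alpha-equivalence by one that also fixes a given set of names.\<close>

lemma perm_extending_injection:
  assumes "finite A" "inj_on f A"
  shows "\<exists>p. \<forall>x\<in>A. permN p x = f x"
  using assms
proof (induction A rule: finite_induct)
  case (insert a A)
  then obtain p where p: "\<forall>x\<in>A. permN p x = f x" by auto
  have "permN p y \<noteq> permN p a \<and> permN p y \<noteq> f a" if "y \<in> A" for y
  proof -
    have "permN p y = f y" "f y \<noteq> f a" "y \<noteq> a" using that insert p by (auto simp: image_iff)
    then show ?thesis using permN_eq_iff[of p y a] by metis
  qed
  then have "\<forall>x\<in>insert a A. permN ((permN p a, f a) # p) x = f x"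
    using p by (simp add: swapN_def)
  then show ?case by blast
qed simp

text \<open>Entailment by a frame asks for some alpha-variant with fresh binders; by equivariance
  every such variant gives the same answer.\<close>

lemma frame_ent_fresh:
  assumes fresh: "set bs \<inter> suppC S \<phi> = {}"
  shows "frame_ent S (bs, \<Psi>) \<phi> \<longleftrightarrow> ent S \<Psi> \<phi>"
proof
  assume "ent S \<Psi> \<phi>"
  then show "frame_ent S (bs, \<Psi>) \<phi>"
    using fresh by (auto simp: frame_ent_def intro!: exI[of _ bs] exI[of _ \<Psi>])
next
  assume "frame_ent S (bs, \<Psi>) \<phi>"
  then obtain p where p: "fixes_names p (suppA S \<Psi> - set bs)"
    "permN p ` set bs \<inter> suppC S \<phi> = {}" "ent S (pA p \<Psi>) \<phi>"
    unfolding frame_ent_def alphaF_iff_perm by auto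
  \<comment> \<open>The witness \<open>p\<close> may move names of \<open>\<phi>\<close>, so it is
    replaced by a permutation that is the identity on them and agrees with \<open>p\<close> on
    \<open>\<Psi>\<close>. There is no clash, since \<open>p\<close> maps binders outside
    \<open>\<phi>\<close> and fixes the free names of the frame.\<close>
  define f where "f x = (if x \<in> suppC S \<phi> then x else permN p x)" for x
  have f: "f x = permN p x" if "x \<in> suppA S \<Psi>" for x
    using that fresh p(1) by (cases "x \<in> set bs") (auto simp: f_def fixes_names_def)
  have collide: False if "x \<in> suppC S \<phi>" "y \<in> suppA S \<Psi>" "y \<notin> suppC S \<phi>" "x = permN p y" for x y
    using that p(1,2) by (cases "y \<in> set bs") (auto simp: fixes_names_def)
  have "inj_on f (suppA S \<Psi> \<union> suppC S \<phi>)"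
    unfolding inj_on_def f_def using collide by (auto split: if_splits)
  then obtain q where q: "\<And>x. x \<in> suppA S \<Psi> \<union> suppC S \<phi> \<Longrightarrow> permN q x = f x"
    using perm_extending_injection[of "suppA S \<Psi> \<union> suppC S \<phi>" f] by auto
  have "pA q \<Psi> = pA p \<Psi>"
    using q f by (intro pA_cong) simp
  moreover have "pC q \<phi> = \<phi>"
    using q by (intro pC_fixes) (simp add: fixes_names_def f_def)
  ultimately show "ent S \<Psi> \<phi>"
    using p(3) ent_perm[of q \<Psi> \<phi>] by simp
qed

lemma isFrame_fresh:
  assumes "isFrame S P (bs, \<Psi>)" "finite X"
  obtains s where "isFrame S P (map (permN s) bs, pA s \<Psi>)" "permN s ` set bs \<inter> X = {}"
    "\<And>x. x \<in> X \<Longrightarrow> x \<notin> set bs \<Longrightarrow> permN s x = x" "fixes_names s (suppA S \<Psi> - set bs)"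
proof -
  obtain s where s: "permN s ` set bs \<inter> (X \<union> suppA S \<Psi>) = {}"
    "\<And>x. x \<in> X \<union> suppA S \<Psi> \<Longrightarrow> x \<notin> set bs \<Longrightarrow> permN s x = x"
    by (rule fresh_renaming_fixing[of "set bs" "X \<union> suppA S \<Psi>"]) (use assms(2) in simp_all)
  have fixed: "fixes_names s (suppA S \<Psi> - set bs)"
    using s(2) by (simp add: fixes_names_def)
  show ?thesis
    by (rule that[OF isFrame_rename[OF assms(1) fixed] _ _ fixed]) (use s in auto)
qed

section \<open>Residuals\<close>

text \<open>The subject gets a permutation of its own: it is tied to agent and environment through
  channel equivalence, whereas object and bound names go with the derivative, because an output
  binds into both.\<close>

primrec permAct :: "perm \<Rightarrow> perm \<Rightarrow> 't action \<Rightarrow> 't action" where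
  "permAct p r (AOut M as N) = AOut (pT p M) (map (permN r) as) (pT r N)"
| "permAct p r (AIn K N) = AIn (pT p K) (pT r N)"
| "permAct p r ATau = ATau"

lemma bnAct_permAct [simp]: "bnAct (permAct p r \<alpha>) = permN r ` bnAct \<alpha>"
  by (cases \<alpha>) auto

lemma finite_bnAct [simp]: "finite (bnAct \<alpha>)"
  by (cases \<alpha>) auto

lemma finite_nAct [simp]: "finite (nAct S \<alpha>)"
  by (cases \<alpha>) auto

lemma permAct_cong:
  assumes "\<And>a. a \<in> nAct S \<alpha> \<Longrightarrow> permN p a = permN q a"
    "\<And>a. a \<in> nAct S \<alpha> \<union> bnAct \<alpha> \<Longrightarrow> permN r a = permN s a"
  shows "permAct p r \<alpha> = permAct q s \<alpha>"
  using assms by (cases \<alpha>) (auto intro!: pT_cong)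

lemma alphaRes_OutI:
  assumes fixed: "fixes_names p ((suppT S N \<union> fnP S P) - set as)"
    and "set cs = permN p ` set as" "N' = pT p N" and alpha: "alpha S (pP p P) P'"
  shows "alphaRes S (AOut M as N) P (AOut M cs N') P'"
proof -
  have "(suppT S N \<union> fnP S P) - set as = permN p ` ((suppT S N \<union> fnP S P) - set as)"
    using fixes_image[OF fixed] by simp
  also have "\<dots> = (suppT S N' \<union> fnP S P') - set cs"
    using alpha_fnP[OF alpha] by (simp add: image_Un assms(2,3))
  finally have eq: "(suppT S N \<union> fnP S P) - set as = \<dots>" .
  show ?thesis unfolding alphaRes.simps
    using eq fixed assms(2-4) by blast
qed

lemma alphaRes_OutE:
  assumes "alphaRes S (AOut M as N) P \<beta> P'"
  obtains p cs where "\<beta> = AOut M cs (pT p N)" "set cs = permN p ` set as"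
    "fixes_names p ((suppT S N \<union> fnP S P) - set as)" "alpha S (pP p P) P'"
proof (cases \<beta>)
  case (AOut M' cs N')
  then show ?thesis using assms that unfolding AOut alphaRes.simps by metis
qed (use assms in simp_all)

lemma alphaRes_alpha: "alpha S P P' \<Longrightarrow> alphaRes S \<alpha> P \<alpha> P'"
  by (cases \<alpha>) (auto intro!: alphaRes_OutI[where p="[]"] simp: fixes_names_def simp del: alphaRes.simps(1))

lemma alphaRes_trans:
  assumes "alphaRes S \<alpha> P \<beta> Q" "alphaRes S \<beta> Q \<gamma> R"
  shows "alphaRes S \<alpha> P \<gamma> R"
proof (cases \<alpha>)
  case (AOut M as N)
  obtain p cs where p: "\<beta> = AOut M cs (pT p N)" "set cs = permN p ` set as"
    "fixes_names p ((suppT S N \<union> fnP S P) - set as)" "alpha S (pP p P) Q"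
    using assms(1) unfolding AOut by (rule alphaRes_OutE)
  obtain q ds where q: "\<gamma> = AOut M ds (pT q (pT p N))" "set ds = permN q ` set cs"
    "fixes_names q ((suppT S (pT p N) \<union> fnP S Q) - set cs)" "alpha S (pP q Q) R"
    using assms(2) unfolding p(1) by (rule alphaRes_OutE)
  have "(suppT S (pT p N) \<union> fnP S Q) - set cs = permN p ` ((suppT S N \<union> fnP S P) - set as)"
    using alpha_fnP[OF p(4)] p(2) by (simp add: image_Un)
  then have "fixes_names (q @ p) ((suppT S N \<union> fnP S P) - set as)"
    using p(3) q(3) fixes_image[OF p(3)] by (intro fixes_append) simp_all
  moreover have "alpha S (pP (q @ p) P) R"
    unfolding pP_append using alpha_trans[OF alpha_perm[OF p(4)] q(4)] .
  ultimately show ?thesis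
    unfolding AOut q(1) by (intro alphaRes_OutI) (auto simp: p(2) q(2) permBy_append image_image)
next
  case (AIn M N)
  then show ?thesis using assms by (cases \<beta>; cases \<gamma>) (auto intro: alpha_trans)
next
  case ATau
  then show ?thesis using assms by (cases \<beta>; cases \<gamma>) (auto intro: alpha_trans)
qed

text \<open>Alpha-equivalence of residuals leaves the subject alone, so the subject may be permuted
  by an unrelated \<open>p\<close>.\<close>

lemma alphaRes_perm:
  assumes "alphaRes S \<alpha> P \<beta> Q"
  shows "alphaRes S (permAct p r \<alpha>) (pP r P) (permAct p r \<beta>) (pP r Q)"
proof (cases \<alpha>)
  case (AOut M as N)
  obtain q cs where q: "\<beta> = AOut M cs (pT q N)" "set cs = permN q ` set as"
    "fixes_names q ((suppT S N \<union> fnP S P) - set as)" "alpha S (pP q P) Q"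
    using assms(1) unfolding AOut by (rule alphaRes_OutE)
  let ?q = "r @ q @ rev r"
  have "fixes_names ?q (permN r ` ((suppT S N \<union> fnP S P) - set as))"
    using q(3) by (rule fixes_conj)
  then have "fixes_names ?q ((suppT S (pT r N) \<union> fnP S (pP r P)) - set (map (permN r) as))"
    by (simp add: image_Un)
  then show ?thesis unfolding AOut q(1) permAct.simps
    by (rule alphaRes_OutI)
      (use q(2) alpha_perm[OF q(4), of r] in \<open>auto simp: permBy_append pP_append image_image\<close>)
next
  case (AIn M N)
  then show ?thesis using assms by (cases \<beta>) (auto intro: alpha_perm)
next
  case ATau
  then show ?thesis using assms by (cases \<beta>) (auto intro: alpha_perm)
qed

lemma alpha_Res_rename:
  assumes "c \<notin> fnP S P"
  shows "alpha S (PRes c (pP [(b, c)] P)) (PRes b P)"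
proof (rule alpha_ResI[where p="[(b, c)]"])
  show "fixes_names [(b, c)] (fnP S (pP [(b, c)] P) - {c})"
    using assms by (auto simp: fixes_names_def swapN_def)
  have "pP [(b, c)] (pP [(b, c)] P) = P"
    using pP_rev(1)[of "[(b, c)]" P] by simp
  then show "alpha S (pP [(b, c)] (pP [(b, c)] P)) P" by simp
qed (simp add: swapN_def)

lemma pP_resList: "pP p (resList as P) = resList (map (permN p) as) (pP p P)"
  by (induction as) (simp_all add: resList_def)

lemma fnP_resList: "fnP S (resList as P) = fnP S P - set as"
  by (induction as) (auto simp: resList_def)

lemma alpha_fixes: "fixes_names p (fnP S P) \<Longrightarrow> alpha S (pP p P) P"
  using alpha_perm_cong[of P p "[]"] by (simp add: fixes_names_def)

lemma isFrame_supp: "isFrame S P F \<Longrightarrow> suppA S (snd F) - set (fst F) \<subseteq> fnP S P"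
proof -
  have alphaF: "suppA S (snd F) - set (fst F) = suppA S \<Psi> - set bs" if "alphaF S F (bs, \<Psi>)" for F bs \<Psi>
    using that unfolding alphaF_def by (simp only: case_prod_beta fst_conv snd_conv) blast
  have unit: "suppA S (unitA S) = {}"
    by (simp add: suppA_def supp_of_def swap_ops(3))
  show "isFrame S P F \<Longrightarrow> ?thesis"
  proof (induction rule: isFrame.induct)
    case (fPar P b1 \<Psi>1 Q b2 \<Psi>2 F)
    then show ?case using supp_comp[of \<Psi>1 \<Psi>2] unfolding alphaF[OF fPar.hyps(5)] by auto
  next
    case (fRes P bs \<Psi> F x)
    then show ?case unfolding alphaF[OF fRes.hyps(2)] by auto
  qed (simp_all add: alphaF unit)
qed

section \<open>Transitions under permutations and equivalent assertions\<close>

text \<open>Only rule \<open>Open\<close> adds a bound name, and it requires that name in the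
  object. Raw actions do not enforce this, while rule \<open>Scope\<close> checks freshness against
  \<open>nAct\<close> alone.\<close>

lemma trans_bn_subset:
  "trans S \<Psi> P \<alpha> P' \<Longrightarrow> bnAct \<alpha> \<subseteq> nAct S \<alpha>"
proof -
  have "trans S \<Psi> P \<alpha> P' \<Longrightarrow> \<forall>M as N. \<alpha> = AOut M as N \<longrightarrow> set as \<subseteq> suppT S N"
  proof (induction rule: trans.induct)
    case (Alpha \<Psi> P \<alpha> P' Q \<beta> Q')
    show ?case
    proof (intro allI impI)
      fix M cs N' assume \<beta>: "\<beta> = AOut M cs N'"
      obtain as N where \<alpha>: "\<alpha> = AOut M as N"
        using Alpha.hyps(3) unfolding \<beta> by (cases \<alpha>) auto
      obtain p where "N' = pT p N" "set cs = permN p ` set as"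
        using Alpha.hyps(3) unfolding \<alpha> \<beta> by (rule alphaRes_OutE) auto
      then show "set cs \<subseteq> suppT S N'" using Alpha.IH \<alpha> by auto
    qed
  qed auto
  then show "trans S \<Psi> P \<alpha> P' \<Longrightarrow> ?thesis" by (cases \<alpha>) auto
qed

lemma trans_alpha: "trans S \<Psi> P \<alpha> P' \<Longrightarrow> alpha S P Q \<Longrightarrow> alpha S P' Q' \<Longrightarrow> trans S \<Psi> Q \<alpha> Q'"
  by (rule trans.Alpha[OF _ _ alphaRes_alpha])

lemma ent_assert_eq: "assert_eq S \<Psi>' (pA p \<Psi>) \<Longrightarrow> ent S \<Psi> \<phi> \<Longrightarrow> ent S \<Psi>' (pC p \<phi>)"
  by (simp add: assert_eq_def)

text \<open>The bound names of the two frames and of the output are renamed separately: those of the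
  frames by \<open>s\<close>, which is applied to everything but the residuals, those of the output by
  \<open>t\<close>, which is applied to the residuals only.\<close>
lemma com_premises_perm:
  assumes frames: "isFrame S P (bP, \<Psi>P)" "isFrame S Q (bQ, \<Psi>Q)"
    and bP: "set bP \<inter> (suppA S \<Psi> \<union> set bQ \<union> fnP S Q \<union> suppT S M \<union> fnP S P) = {}"
    and bQ: "set bQ \<inter> (suppA S \<Psi> \<union> set bP \<union> fnP S P \<union> suppT S K \<union> fnP S Q) = {}"
    and P: "\<And>p r \<Psi>'. (\<And>a. a \<in> fnP S P \<Longrightarrow> permN p a = permN r a) \<Longrightarrow>
      assert_eq S \<Psi>' (pA p (comp S \<Psi>Q \<Psi>)) \<Longrightarrow>
      trans S \<Psi>' (pP p P) (permAct p r (AOut M as N)) (pP r P')"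
    and Q: "\<And>p r \<Psi>'. (\<And>a. a \<in> fnP S Q \<Longrightarrow> permN p a = permN r a) \<Longrightarrow>
      assert_eq S \<Psi>' (pA p (comp S \<Psi>P \<Psi>)) \<Longrightarrow>
      trans S \<Psi>' (pP p Q) (permAct p r (AIn K N)) (pP r Q')"
    and ent: "ent S (comp S (comp S \<Psi> \<Psi>P) \<Psi>Q) (chEq S M K)"
    and as: "set as \<inter> fnP S Q = {}"
    and agree: "\<And>a. a \<in> fnP S P \<union> fnP S Q \<Longrightarrow> permN p a = permN r a"
    and \<Psi>': "assert_eq S \<Psi>' (pA p \<Psi>)"
  obtains bP' \<Psi>P' bQ' \<Psi>Q' M' K' N' t where
    "isFrame S (pP p P) (bP', \<Psi>P')" "isFrame S (pP p Q) (bQ', \<Psi>Q')"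
    "set bP' \<inter> (suppA S \<Psi>' \<union> set bQ' \<union> fnP S (pP p Q) \<union> suppT S M' \<union> fnP S (pP p P)) = {}"
    "set bQ' \<inter> (suppA S \<Psi>' \<union> set bP' \<union> fnP S (pP p P) \<union> suppT S K' \<union> fnP S (pP p Q)) = {}"
    "trans S (comp S \<Psi>Q' \<Psi>') (pP p P) (AOut M' (map (permN (t @ r)) as) N') (pP (t @ r) P')"
    "trans S (comp S \<Psi>P' \<Psi>') (pP p Q) (AIn K' N') (pP (t @ r) Q')"
    "ent S (comp S (comp S \<Psi>' \<Psi>P') \<Psi>Q') (chEq S M' K')"
    "permN (t @ r) ` set as \<inter> fnP S (pP p Q) = {}"
    "fixes_names t (fnP S (pP r P') \<union> fnP S (pP r Q') - permN r ` set as)"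
proof -
  define X where "X = suppA S \<Psi>' \<union> suppA S (pA p \<Psi>) \<union> fnP S (pP p P) \<union> fnP S (pP p Q) \<union>
    suppA S (pA p \<Psi>P) \<union> suppA S (pA p \<Psi>Q)"
  obtain s where s: "permN s ` (permN p ` (set bP \<union> set bQ)) \<inter> X = {}"
    "\<And>x. x \<in> X \<Longrightarrow> x \<notin> permN p ` (set bP \<union> set bQ) \<Longrightarrow> permN s x = x"
    by (rule fresh_renaming_fixing[of "permN p ` (set bP \<union> set bQ)" X]) (simp_all add: X_def)
  define Y where "Y = suppT S (pT r N) \<union> fnP S (pP r P') \<union> fnP S (pP r Q') \<union> fnP S (pP p Q)"
  obtain t where t: "permN t ` (permN r ` set as) \<inter> Y = {}"
    "\<And>x. x \<in> Y \<Longrightarrow> x \<notin> permN r ` set as \<Longrightarrow> permN t x = x"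
    by (rule fresh_renaming_fixing[of "permN r ` set as" Y]) (simp_all add: Y_def)
  \<comment> \<open>The subjects are permuted by \<open>?q\<close> too: each may contain binders of
    the partner's frame, so \<open>s\<close> need not fix it.\<close>
  let ?q = "s @ p"
  have sP: "permN s (permN p a) = permN p a" if "a \<in> fnP S P \<union> fnP S Q \<union> suppA S \<Psi>" for a
    using that bP bQ by (intro s(2)) (auto simp: X_def)
  have s\<Psi>: "pA ?q \<Psi> = pA p \<Psi>"
    using sP by (intro pA_cong) simp
  have alphaP: "alpha S (pP ?q P) (pP p P)" and alphaQ: "alpha S (pP ?q Q) (pP p Q)"
    using sP by (auto intro!: alpha_perm_cong)
  have "fixes_names s (suppA S (pA p \<Psi>P) - set (map (permN p) bP))"
  proof -
    have "(suppA S \<Psi>P - set bP) \<subseteq> fnP S P" using isFrame_supp[OF frames(1)] by simp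
    then show ?thesis
      unfolding fixes_names_def using sP by (auto simp: subset_iff)
  qed
  from isFrame_rename[OF _ this, of "pP p P"] isFrame_perm[OF frames(1), of p]
  have frameP: "isFrame S (pP p P) (map (permN ?q) bP, pA ?q \<Psi>P)"
    by (simp add: permN_append_fun permBy_append o_def)
  have "fixes_names s (suppA S (pA p \<Psi>Q) - set (map (permN p) bQ))"
  proof -
    have "(suppA S \<Psi>Q - set bQ) \<subseteq> fnP S Q" using isFrame_supp[OF frames(2)] by simp
    then show ?thesis
      unfolding fixes_names_def using sP by (auto simp: subset_iff)
  qed
  from isFrame_rename[OF _ this, of "pP p Q"] isFrame_perm[OF frames(2), of p]
  have frameQ: "isFrame S (pP p Q) (map (permN ?q) bQ, pA ?q \<Psi>Q)"
    by (simp add: permN_append_fun permBy_append o_def)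
  have fresh: "permN ?q ` set bP \<inter> X = {}" "permN ?q ` set bQ \<inter> X = {}"
    using s(1) unfolding permN_append_fun image_Un image_image by blast+
  have fnq: "fnP S (pP p P) = permN ?q ` fnP S P" "fnP S (pP p Q) = permN ?q ` fnP S Q"
    using alpha_fnP[OF alphaP] alpha_fnP[OF alphaQ] by simp_all
  have bP': "set (map (permN ?q) bP) \<inter> (suppA S \<Psi>' \<union> set (map (permN ?q) bQ) \<union> fnP S (pP p Q) \<union>
      suppT S (pT ?q M) \<union> fnP S (pP p P)) = {}"
  proof -
    have "permN ?q ` set bP \<inter> permN ?q ` (set bQ \<union> fnP S Q \<union> suppT S M \<union> fnP S P) = {}"
      using bP unfolding image_permN_disjoint by blast
    moreover have "permN ?q ` set bP \<inter> suppA S \<Psi>' = {}"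
      using fresh(1) unfolding X_def by blast
    ultimately show ?thesis unfolding fnq by (simp add: image_Un Int_Un_distrib)
  qed
  have bQ': "set (map (permN ?q) bQ) \<inter> (suppA S \<Psi>' \<union> set (map (permN ?q) bP) \<union> fnP S (pP p P) \<union>
      suppT S (pT ?q K) \<union> fnP S (pP p Q)) = {}"
  proof -
    have "permN ?q ` set bQ \<inter> permN ?q ` (set bP \<union> fnP S P \<union> suppT S K \<union> fnP S Q) = {}"
      using bQ unfolding image_permN_disjoint by blast
    moreover have "permN ?q ` set bQ \<inter> suppA S \<Psi>' = {}"
      using fresh(2) unfolding X_def by blast
    ultimately show ?thesis unfolding fnq by (simp add: image_Un Int_Un_distrib)
  qed
  have \<Psi>q: "assert_eq S (comp S \<Psi>0 \<Psi>') (comp S \<Psi>0 (pA ?q \<Psi>))" for \<Psi>0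
    unfolding s\<Psi> by (rule comp_cong2[OF \<Psi>'])
  have agreeP: "permN ?q a = permN r a" if "a \<in> fnP S P" for a
    using sP[of a] agree[of a] that by simp
  have fixed: "fixes_names t (suppT S (pT r N) \<union> fnP S (pP r P') - set (map (permN r) as))"
    using t(2) by (auto simp: fixes_names_def Y_def simp del: fnP_perm supp_perm)
  \<comment> \<open>The residual of the sender is permuted by \<open>r\<close>, and \<open>t\<close>
    is then added by alpha-conversion. An input binds nothing, so for the receiver \<open>t\<close>
    has to enter the residual permutation itself; both sides end with the same object.\<close>
  have "trans S (comp S (pA ?q \<Psi>Q) \<Psi>') (pP ?q P) (permAct ?q r (AOut M as N)) (pP r P')"
    by (rule P[OF agreeP]) (simp_all add: \<Psi>q)
  from trans.Alpha[OF this alphaP] alphaRes_OutI[OF fixed]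
  have transP: "trans S (comp S (pA ?q \<Psi>Q) \<Psi>') (pP p P)
      (AOut (pT ?q M) (map (permN (t @ r)) as) (pT (t @ r) N)) (pP (t @ r) P')"
    by (simp add: image_image permBy_append pP_append del: alphaRes.simps)
  \<comment> \<open>The bound names of the output are fresh for \<open>Q\<close>, so
    \<open>t\<close> is trivial on the permuted free names of \<open>Q\<close>.\<close>
  have agreeQ: "permN ?q a = permN (t @ r) a" if "a \<in> fnP S Q" for a
  proof -
    have "permN p a \<notin> permN r ` set as"
      using as agree[of a] that by auto
    then have "permN t (permN p a) = permN p a"
      using that by (intro t(2)) (auto simp: Y_def)
    then show ?thesis using sP[of a] agree[of a] that by simp
  qed
  have "trans S (comp S (pA ?q \<Psi>P) \<Psi>') (pP ?q Q) (permAct ?q (t @ r) (AIn K N)) (pP (t @ r) Q')"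
    by (rule Q[OF agreeQ]) (simp_all add: \<Psi>q)
  then have transQ: "trans S (comp S (pA ?q \<Psi>P) \<Psi>') (pP p Q) (AIn (pT ?q K) (pT (t @ r) N)) (pP (t @ r) Q')"
    using trans_alpha[OF _ alphaQ alpha_refl] by simp
  have "assert_eq S (comp S (comp S \<Psi>' (pA ?q \<Psi>P)) (pA ?q \<Psi>Q)) (pA ?q (comp S (comp S \<Psi> \<Psi>P) \<Psi>Q))"
    unfolding comp_perm s\<Psi> by (intro comp_cong1 \<Psi>')
  from ent_assert_eq[OF this ent]
  have ent': "ent S (comp S (comp S \<Psi>' (pA ?q \<Psi>P)) (pA ?q \<Psi>Q)) (chEq S (pT ?q M) (pT ?q K))"
    by (simp only: chEq_perm)
  have as': "permN (t @ r) ` set as \<inter> fnP S (pP p Q) = {}"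
    using t(1) unfolding Y_def permN_append_fun image_image by blast
  have "fixes_names t (fnP S (pP r P') \<union> fnP S (pP r Q') - permN r ` set as)"
    using t(2) by (auto simp: fixes_names_def Y_def simp del: fnP_perm)
  with frameP frameQ bP' bQ' transP transQ ent' as' show thesis by (rule that)
qed

text \<open>Below a restriction of \<open>b\<close> the two permutations need not agree at
  \<open>b\<close>. Sending \<open>b\<close> to one common fresh name makes them agree on the whole
  body, as an induction hypothesis for the body demands.\<close>

lemma scope_fresh_name:
  assumes "finite X"
    and agree: "\<And>a. a \<in> fnP S P - {b} \<Longrightarrow> permN p a = permN r a"
  obtains c where "c \<notin> X" "c \<notin> fnP S (pP p P)" "c \<notin> fnP S (pP r P')"
    "\<And>a. a \<in> fnP S P \<Longrightarrow> permN ((permN p b, c) # p) a = permN ((permN r b, c) # r) a"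
proof -
  have "finite (X \<union> permN p ` fnP S P \<union> permN r ` fnP S P \<union> permN r ` fnP S P' \<union> {permN p b, permN r b})"
    using assms(1) by simp
  then obtain c where c: "c \<notin> X \<union> permN p ` fnP S P \<union> permN r ` fnP S P \<union> permN r ` fnP S P' \<union> {permN p b, permN r b}"
    using ex_new_if_finite[OF infinite_UNIV_nat] by metis
  have "permN ((permN p b, c) # p) a = permN ((permN r b, c) # r) a" if a: "a \<in> fnP S P" for a
  proof (cases "a = b")
    case True
    then show ?thesis by (simp add: swapN_def)
  next
    case False
    then have "permN p a = permN r a" "permN p a \<noteq> c" "permN r a \<noteq> c"
      using agree[of a] a c by auto
    then show ?thesis using False by (auto simp: swapN_def)
  qed
  then show thesis by (intro that[of c]) (use c in auto)
qed

lemma permN_swap_fresh: "a \<noteq> b \<Longrightarrow> c \<noteq> permN p a \<Longrightarrow> permN ((permN p b, c) # p) a = permN p a"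
  by (simp add: swapN_def)

lemma pP_Cons: "pP (x # p) P = pP [x] (pP p P)"
  using pP_append[of "[x]" p P] by simp

text \<open>The residual may be permuted by any \<open>r\<close> that agrees with \<open>p\<close> on the free names of
  the agent only.  This freedom is what makes the induction go through: an input may put names into
  the derivative that are hidden in the action, so the derivative may contain bound names of frames
  and of restrictions, and these must not be renamed along with the binders.\<close>
theorem trans_perm:
  assumes "trans S \<Psi> P \<alpha> P'" "\<And>a. a \<in> fnP S P \<Longrightarrow> permN p a = permN r a" "assert_eq S \<Psi>' (pA p \<Psi>)"
  shows "trans S \<Psi>' (pP p P) (permAct p r \<alpha>) (pP r P')"
  using assms
proof (induction arbitrary: p r \<Psi>' rule: trans.induct)
  case (In \<Psi> M K Ls ys P P0 N)
  \<comment> \<open>Rule \<open>In\<close> is applied to the agent permuted by \<open>r\<close>,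
    because object and derivative carry the substituted terms, whose names are arbitrary. The prefix
    subject has only free names of the agent, where \<open>p\<close> and \<open>r\<close>
    agree.\<close>
  have M: "pT r M = pT p M"
    using In.prems(1) by (intro pT_cong) simp
  have "ent S \<Psi>' (chEq S (pT r M) (pT p K))"
    using ent_assert_eq[OF In.prems(2) In.hyps(1)] by (simp add: chEq_perm M)
  moreover have "bnP (pP r P0) \<inter> (set (map (permN r) ys) \<union> suppTs S (map (pT r) Ls)) = {}"
  proof -
    have "suppTs S (map (pT r) Ls) = permN r ` suppTs S Ls"
      by (auto simp: suppTs_def)
    then show ?thesis using In.hyps(4) by (simp flip: image_Un)
  qed
  ultimately have "trans S \<Psi>' (pP r (PIn M ys N P)) (AIn (pT p K) (pT r (substT S N ys Ls)))
      (pP r (rsubst S P0 ys Ls))"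
    unfolding pP_simps subst_perm rsubst_perm
    using In.hyps(2) alpha_perm[OF In.hyps(3)] by (intro trans.In) simp_all
  moreover have "alpha S (pP r (PIn M ys N P)) (pP p (PIn M ys N P))"
    by (rule alpha_perm_cong) (simp only: In.prems(1))
  ultimately show ?case by (auto intro: trans_alpha)
next
  case (Out \<Psi> M K N P)
  have "ent S \<Psi>' (chEq S (pT p M) (pT p K))"
    using ent_assert_eq[OF Out.prems(2) Out.hyps(1)] by (simp add: chEq_perm)
  moreover have "pT r N = pT p N"
    using Out.prems(1) by (intro pT_cong) simp
  ultimately have "trans S \<Psi>' (pP p (POut M N P)) (permAct p r (AOut K [] N)) (pP p P)"
    by (auto intro: trans.Out)
  moreover have "alpha S (pP p P) (pP r P)"
    using Out.prems(1) by (intro alpha_perm_cong) simp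
  ultimately show ?case by (auto intro: trans_alpha)
next
  case (Case \<Psi> P \<alpha> P' \<phi> cs)
  have "fnP S P \<subseteq> fnP S (PCase cs)"
    using Case.hyps(2) unfolding fnP_PCase by force
  then have "trans S \<Psi>' (pP p P) (permAct p r \<alpha>) (pP r P')"
    using Case.prems by (intro Case.IH) blast
  moreover have "(pC p \<phi>, pP p P) \<in> set (map (map_prod (pC p) (pP p)) cs)"
    using Case.hyps(2) by force
  ultimately show ?case
    unfolding pP_simps using ent_assert_eq[OF Case.prems(2) Case.hyps(3)] by (rule trans.Case)
next
  case (Com1 P bP \<Psi>P Q bQ \<Psi>Q \<Psi> M K as N P' Q')
  obtain bP' \<Psi>P' bQ' \<Psi>Q' M' K' N' t where *:
    "isFrame S (pP p P) (bP', \<Psi>P')" "isFrame S (pP p Q) (bQ', \<Psi>Q')"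
    "set bP' \<inter> (suppA S \<Psi>' \<union> set bQ' \<union> fnP S (pP p Q) \<union> suppT S M' \<union> fnP S (pP p P)) = {}"
    "set bQ' \<inter> (suppA S \<Psi>' \<union> set bP' \<union> fnP S (pP p P) \<union> suppT S K' \<union> fnP S (pP p Q)) = {}"
    "trans S (comp S \<Psi>Q' \<Psi>') (pP p P) (AOut M' (map (permN (t @ r)) as) N') (pP (t @ r) P')"
    "trans S (comp S \<Psi>P' \<Psi>') (pP p Q) (AIn K' N') (pP (t @ r) Q')"
    "ent S (comp S (comp S \<Psi>' \<Psi>P') \<Psi>Q') (chEq S M' K')"
    "permN (t @ r) ` set as \<inter> fnP S (pP p Q) = {}"
    and t: "fixes_names t (fnP S (pP r P') \<union> fnP S (pP r Q') - permN r ` set as)"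
  proof (rule com_premises_perm[OF Com1.hyps(1-4) Com1.IH Com1.hyps(7,8) _ Com1.prems(2)])
    show "permN p a = permN r a" if "a \<in> fnP S P \<union> fnP S Q" for a
      using that Com1.prems(1) by auto
  qed (assumption | blast | (rule that; assumption))+
  have "trans S \<Psi>' (pP p (PPar P Q)) ATau (resList (map (permN (t @ r)) as) (PPar (pP (t @ r) P') (pP (t @ r) Q')))"
    unfolding pP_simps by (rule trans.Com1[OF *(1-7)]) (use *(8) in simp)
  also have "resList (map (permN (t @ r)) as) (PPar (pP (t @ r) P') (pP (t @ r) Q')) =
      pP t (pP r (resList as (PPar P' Q')))"
    by (simp add: pP_resList pP_append permN_append_fun o_def)
  finally have "trans S \<Psi>' (pP p (PPar P Q)) ATau (pP t (pP r (resList as (PPar P' Q'))))" .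
  \<comment> \<open>The output names are restricted by \<open>resList\<close>, so \<open>t\<close>
    fixes every free name of the result.\<close>
  moreover have "alpha S (pP t (pP r (resList as (PPar P' Q')))) (pP r (resList as (PPar P' Q')))"
    by (rule alpha_fixes) (use t in \<open>simp add: fnP_resList image_Un\<close>)
  ultimately show ?case by (auto intro: trans_alpha)
next
  case (Com2 P bP \<Psi>P Q bQ \<Psi>Q \<Psi> K M N P' as Q')
  obtain bQ' \<Psi>Q' bP' \<Psi>P' M' K' N' t where *:
    "isFrame S (pP p Q) (bQ', \<Psi>Q')" "isFrame S (pP p P) (bP', \<Psi>P')"
    "set bQ' \<inter> (suppA S \<Psi>' \<union> set bP' \<union> fnP S (pP p P) \<union> suppT S M' \<union> fnP S (pP p Q)) = {}"
    "set bP' \<inter> (suppA S \<Psi>' \<union> set bQ' \<union> fnP S (pP p Q) \<union> suppT S K' \<union> fnP S (pP p P)) = {}"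
    "trans S (comp S \<Psi>P' \<Psi>') (pP p Q) (AOut M' (map (permN (t @ r)) as) N') (pP (t @ r) Q')"
    "trans S (comp S \<Psi>Q' \<Psi>') (pP p P) (AIn K' N') (pP (t @ r) P')"
    "ent S (comp S (comp S \<Psi>' \<Psi>Q') \<Psi>P') (chEq S M' K')"
    "permN (t @ r) ` set as \<inter> fnP S (pP p P) = {}"
    and t: "fixes_names t (fnP S (pP r Q') \<union> fnP S (pP r P') - permN r ` set as)"
  proof (rule com_premises_perm[OF Com2.hyps(2,1,4,3) Com2.IH(2,1) Com2.hyps(7,8) _ Com2.prems(2)])
    show "permN p a = permN r a" if "a \<in> fnP S Q \<union> fnP S P" for a
      using that Com2.prems(1) by auto
  qed (assumption | blast | (rule that; assumption))+
  have "trans S \<Psi>' (pP p (PPar P Q)) ATau (resList (map (permN (t @ r)) as) (PPar (pP (t @ r) P') (pP (t @ r) Q')))"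
    unfolding pP_simps by (rule trans.Com2[OF *(2,1,4,3,6,5,7)]) (use *(8) in simp)
  also have "resList (map (permN (t @ r)) as) (PPar (pP (t @ r) P') (pP (t @ r) Q')) =
      pP t (pP r (resList as (PPar P' Q')))"
    by (simp add: pP_resList pP_append permN_append_fun o_def)
  finally have "trans S \<Psi>' (pP p (PPar P Q)) ATau (pP t (pP r (resList as (PPar P' Q'))))" .
  moreover have "alpha S (pP t (pP r (resList as (PPar P' Q')))) (pP r (resList as (PPar P' Q')))"
    by (rule alpha_fixes) (use t in \<open>simp add: fnP_resList image_Un Un_commute\<close>)
  ultimately show ?case by (auto intro: trans_alpha)
next
  case (Par1 Q bQ \<Psi>Q \<Psi> P \<alpha> P')
  \<comment> \<open>The object is permuted by \<open>r\<close>, which may produce binders of the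
    frame permuted by \<open>p\<close>; \<open>s\<close> moves these away from the new action. The
    image of the old action under \<open>p\<close> is included so that \<open>s\<close> leaves the
    subject unchanged.\<close>
  let ?X = "suppA S \<Psi>' \<union> suppA S (pA p \<Psi>) \<union> fnP S (pP p P) \<union>
    nAct S (permAct p r \<alpha>) \<union> permN p ` nAct S \<alpha>"
  have "isFrame S (pP p Q) (map (permN p) bQ, pA p \<Psi>Q)"
    using isFrame_perm[OF Par1.hyps(1), of p] by simp
  then obtain s where s: "isFrame S (pP p Q) (map (permN s) (map (permN p) bQ), pA s (pA p \<Psi>Q))"
    "permN s ` set (map (permN p) bQ) \<inter> ?X = {}"
    "\<And>x. x \<in> ?X \<Longrightarrow> x \<notin> set (map (permN p) bQ) \<Longrightarrow> permN s x = x"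
    by (rule isFrame_fresh[where X="?X"]) (simp, blast)
  have sp: "permN (s @ p) a = permN p a" if "a \<in> suppA S \<Psi> \<union> fnP S P \<union> nAct S \<alpha>" for a
    unfolding permN_append using that Par1.hyps(2) by (intro s(3)) auto
  have "pA s (pA p \<Psi>) = pA p \<Psi>"
    using sp unfolding permBy_append[symmetric] by (intro pA_cong) simp
  then have "trans S (comp S (pA s (pA p \<Psi>Q)) \<Psi>') (pP (s @ p) P) (permAct (s @ p) r \<alpha>) (pP r P')"
    using sp Par1.prems comp_cong2
    by (intro Par1.IH) (auto simp: permBy_append simp del: permN_append)
  moreover have "permAct (s @ p) r \<alpha> = permAct p r \<alpha>"
    using sp by (intro permAct_cong) simp_all
  moreover have "alpha S (pP (s @ p) P) (pP p P)"
    using sp by (intro alpha_perm_cong) simp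
  ultimately have *: "trans S (comp S (pA s (pA p \<Psi>Q)) \<Psi>') (pP p P) (permAct p r \<alpha>) (pP r P')"
    by (auto intro: trans_alpha)
  have "permN p ` fnP S Q = permN r ` fnP S Q"
    using Par1.prems(1) by (intro image_cong) auto
  then have bn: "bnAct (permAct p r \<alpha>) \<inter> fnP S (pP p Q) = {}"
    using Par1.hyps(4) by simp
  have "trans S \<Psi>' (PPar (pP p P) (pP p Q)) (permAct p r \<alpha>) (PPar (pP r P') (pP p Q))"
    by (rule trans.Par1[OF s(1) _ * bn]) (use s(2) in \<open>auto simp: image_image\<close>)
  \<comment> \<open>The idle component is permuted by \<open>p\<close> in the source but by
    \<open>r\<close> in the required derivative; the two agree on its free names.\<close>
  moreover have "alpha S (pP p Q) (pP r Q)"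
    using Par1.prems(1) by (intro alpha_perm_cong) simp
  ultimately show ?case unfolding pP_simps
    by (rule trans_alpha[OF _ alpha_refl alpha.aPar[OF alpha_refl]])
next
  case (Par2 P bP \<Psi>P \<Psi> Q \<alpha> Q')
  let ?X = "suppA S \<Psi>' \<union> suppA S (pA p \<Psi>) \<union> fnP S (pP p Q) \<union>
    nAct S (permAct p r \<alpha>) \<union> permN p ` nAct S \<alpha>"
  have "isFrame S (pP p P) (map (permN p) bP, pA p \<Psi>P)"
    using isFrame_perm[OF Par2.hyps(1), of p] by simp
  then obtain s where s: "isFrame S (pP p P) (map (permN s) (map (permN p) bP), pA s (pA p \<Psi>P))"
    "permN s ` set (map (permN p) bP) \<inter> ?X = {}"
    "\<And>x. x \<in> ?X \<Longrightarrow> x \<notin> set (map (permN p) bP) \<Longrightarrow> permN s x = x"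
    by (rule isFrame_fresh[where X="?X"]) (simp, blast)
  have sp: "permN (s @ p) a = permN p a" if "a \<in> suppA S \<Psi> \<union> fnP S Q \<union> nAct S \<alpha>" for a
    unfolding permN_append using that Par2.hyps(2) by (intro s(3)) auto
  have "pA s (pA p \<Psi>) = pA p \<Psi>"
    using sp unfolding permBy_append[symmetric] by (intro pA_cong) simp
  then have "trans S (comp S (pA s (pA p \<Psi>P)) \<Psi>') (pP (s @ p) Q) (permAct (s @ p) r \<alpha>) (pP r Q')"
    using sp Par2.prems comp_cong2
    by (intro Par2.IH) (auto simp: permBy_append simp del: permN_append)
  moreover have "permAct (s @ p) r \<alpha> = permAct p r \<alpha>"
    using sp by (intro permAct_cong) simp_all
  moreover have "alpha S (pP (s @ p) Q) (pP p Q)"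
    using sp by (intro alpha_perm_cong) simp
  ultimately have *: "trans S (comp S (pA s (pA p \<Psi>P)) \<Psi>') (pP p Q) (permAct p r \<alpha>) (pP r Q')"
    by (auto intro: trans_alpha)
  have "permN p ` fnP S P = permN r ` fnP S P"
    using Par2.prems(1) by (intro image_cong) auto
  then have bn: "bnAct (permAct p r \<alpha>) \<inter> fnP S (pP p P) = {}"
    using Par2.hyps(4) by simp
  have "trans S \<Psi>' (PPar (pP p P) (pP p Q)) (permAct p r \<alpha>) (PPar (pP p P) (pP r Q'))"
    by (rule trans.Par2[OF s(1) _ * bn]) (use s(2) in \<open>auto simp: image_image\<close>)
  moreover have "alpha S (pP p P) (pP r P)"
    using Par2.prems(1) by (intro alpha_perm_cong) simp
  ultimately show ?case unfolding pP_simps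
    by (rule trans_alpha[OF _ alpha_refl alpha.aPar[OF _ alpha_refl]])
next
  case (Scope \<Psi> P \<alpha> P' b)
  let ?X = "suppA S \<Psi>' \<union> permN p ` suppA S \<Psi> \<union> nAct S (permAct p r \<alpha>) \<union>
    permN p ` nAct S \<alpha> \<union> permN r ` nAct S \<alpha>"
  obtain c where c: "c \<notin> ?X" "c \<notin> fnP S (pP p P)" "c \<notin> fnP S (pP r P')"
    "\<And>a. a \<in> fnP S P \<Longrightarrow> permN ((permN p b, c) # p) a = permN ((permN r b, c) # r) a"
    by (rule scope_fresh_name[of ?X P b p r P']) (use Scope.prems(1) in auto)
  let ?p = "(permN p b, c) # p" and ?r = "(permN r b, c) # r"
  have "pA ?p \<Psi> = pA p \<Psi>"
    using Scope.hyps(3) c(1) by (intro pA_cong permN_swap_fresh) auto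
  \<comment> \<open>The restricted name is fresh for the action, hence also differs from its bound
    names, so the detour through \<open>c\<close> does not show in the label.\<close>
  moreover have "permAct ?p ?r \<alpha> = permAct p r \<alpha>"
  proof (rule permAct_cong)
    have "bnAct \<alpha> \<subseteq> nAct S \<alpha>" using Scope.hyps(1) by (rule trans_bn_subset)
    then show "permN ?r a = permN r a" if "a \<in> nAct S \<alpha> \<union> bnAct \<alpha>" for a
      using that Scope.hyps(2) c(1) by (intro permN_swap_fresh) auto
    show "permN ?p a = permN p a" if "a \<in> nAct S \<alpha>" for a
      using that Scope.hyps(2) c(1) by (intro permN_swap_fresh) auto
  qed
  ultimately have "trans S \<Psi>' (pP ?p P) (permAct p r \<alpha>) (pP ?r P')"
    using Scope.IH[of ?p ?r \<Psi>'] c(4) Scope.prems(2) by simp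
  then have "trans S \<Psi>' (PRes c (pP ?p P)) (permAct p r \<alpha>) (PRes c (pP ?r P'))"
    using c(1) by (intro trans.Scope) auto
  moreover have "alpha S (PRes c (pP ?p P)) (PRes (permN p b) (pP p P))"
    unfolding pP_Cons[of _ p] using c(2) by (rule alpha_Res_rename)
  moreover have "alpha S (PRes c (pP ?r P')) (PRes (permN r b) (pP r P'))"
    unfolding pP_Cons[of _ r] using c(3) by (rule alpha_Res_rename)
  ultimately show ?case by (auto intro: trans_alpha)
next
  case (Open \<Psi> P M as N P' b)
  let ?X = "suppA S \<Psi>' \<union> permN p ` suppA S \<Psi> \<union> permN p ` suppT S M \<union> suppT S (pT p M) \<union>
    permN r ` suppT S N \<union> permN r ` set as"
  obtain c where c: "c \<notin> ?X" "c \<notin> fnP S (pP p P)" "c \<notin> fnP S (pP r P')"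
    "\<And>a. a \<in> fnP S P \<Longrightarrow> permN ((permN p b, c) # p) a = permN ((permN r b, c) # r) a"
    by (rule scope_fresh_name[of ?X P b p r P']) (use Open.prems(1) in auto)
  let ?p = "(permN p b, c) # p" and ?r = "(permN r b, c) # r"
  have "pA ?p \<Psi> = pA p \<Psi>"
    using Open.hyps(3) c(1) by (intro pA_cong permN_swap_fresh) auto
  moreover have "pT ?p M = pT p M"
    using Open.hyps(4) c(1) by (intro pT_cong permN_swap_fresh) auto
  moreover have as: "map (permN ?r) as = map (permN r) as"
    using Open.hyps(2) c(1) by (intro map_cong[OF refl] permN_swap_fresh) auto
  ultimately have "trans S \<Psi>' (pP ?p P) (AOut (pT p M) (map (permN r) as) (pT ?r N)) (pP ?r P')"
    using Open.IH[OF c(4), of \<Psi>'] Open.prems(2) by (simp only: permAct.simps)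
  then have "trans S \<Psi>' (PRes c (pP ?p P)) (AOut (pT p M) (c # map (permN r) as) (pT ?r N)) (pP ?r P')"
  proof (rule trans.Open)
    have "permN ?r b \<in> suppT S (pT ?r N)" using Open.hyps(5) by (simp only: supp_perm image_permN_mem)
    then show "c \<in> suppT S (pT ?r N)" by (simp add: swapN_def)
  qed (use c(1) in auto)
  moreover have "alpha S (PRes c (pP ?p P)) (PRes (permN p b) (pP p P))"
    unfolding pP_Cons[of _ p] using c(2) by (rule alpha_Res_rename)
  \<comment> \<open>The opened name is \<open>c\<close> here and must become the image of
    \<open>b\<close> under \<open>r\<close>; it is bound in the residual, so swapping it back is an
    alpha-conversion.\<close>
  moreover have "alphaRes S (AOut (pT p M) (c # map (permN r) as) (pT ?r N)) (pP ?r P')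
      (AOut (pT p M) (permN r b # map (permN r) as) (pT r N)) (pP r P')"
  proof (rule alphaRes_OutI[where p="[(permN r b, c)]"])
    have "permN [(permN r b, c)] (permN ?r a) = permN ?r a"
      if "a \<in> suppT S N \<union> fnP S P'" "a \<noteq> b" for a
    proof -
      have "permN r a \<noteq> c" using that(1) c(1,3) by auto
      then show ?thesis using that(2) by (simp add: swapN_def)
    qed
    moreover have "permN ?r b = c" by (simp add: swapN_def)
    ultimately show "fixes_names [(permN r b, c)]
        ((suppT S (pT ?r N) \<union> fnP S (pP ?r P')) - set (c # map (permN r) as))"
      unfolding fixes_names_def supp_perm fnP_perm by force
    have "permN [(permN r b, c)] (permN r a) = permN r a" if "a \<in> set as" for a
      using that Open.hyps(2) c(1) by (auto simp: swapN_def)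
    then have "permN [(permN r b, c)] ` permN r ` set as = permN r ` set as"
      unfolding image_image by (rule image_cong[OF refl])
    moreover have "permN [(permN r b, c)] c = permN r b" by (simp add: swapN_def)
    ultimately show "set (permN r b # map (permN r) as) = permN [(permN r b, c)] ` set (c # map (permN r) as)"
      by (simp only: list.set set_map image_insert)
    show "pT r N = pT [(permN r b, c)] (pT ?r N)"
      using pT_rev(1)[of "[(permN r b, c)]" "pT r N"] by simp
    show "alpha S (pP [(permN r b, c)] (pP ?r P')) (pP r P')"
      using pP_rev(1)[of "[(permN r b, c)]" "pP r P'"] unfolding pP_Cons[of _ r] by simp
  qed
  ultimately show ?case by (auto intro: trans.Alpha simp del: alphaRes.simps)
next
  case (Rep \<Psi> P \<alpha> P')
  then have "trans S \<Psi>' (pP p (PPar P (PBang P))) (permAct p r \<alpha>) (pP r P')"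
    by (intro Rep.IH) auto
  then show ?case by (auto intro: trans.Rep)
next
  case (Alpha \<Psi> P \<alpha> P' Q \<beta> Q')
  have "trans S \<Psi>' (pP p P) (permAct p r \<alpha>) (pP r P')"
    using Alpha.prems alpha_fnP[OF Alpha.hyps(2)] by (intro Alpha.IH) auto
  then show ?case
    using alpha_perm[OF Alpha.hyps(2)] alphaRes_perm[OF Alpha.hyps(3)] by (rule trans.Alpha)
qed

lemma permAct_Nil [simp]: "permAct [] [] \<alpha> = \<alpha>"
  by (cases \<alpha>) simp_all

lemma permAct_rev [simp]:
  "permAct (rev p) (rev r) (permAct p r \<alpha>) = \<alpha>" "permAct [] (rev r) (permAct [] r \<alpha>) = \<alpha>"
  by (cases \<alpha>; simp add: o_def)+

text \<open>The case of empty permutations in \<open>trans_perm\<close>, whose proof renames the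
  binders that clash with the support of the new assertion.\<close>

lemma trans_assert_eq: "assert_eq S \<Psi>' \<Psi> \<Longrightarrow> trans S \<Psi> P \<alpha> P' \<Longrightarrow> trans S \<Psi>' P \<alpha> P'"
  using trans_perm[of \<Psi> P \<alpha> P' "[]" "[]" \<Psi>'] by simp

lemma trans_equivariant:
  "trans S \<Psi> P \<alpha> P' \<Longrightarrow> trans S (pA p \<Psi>) (pP p P) (permAct p p \<alpha>) (pP p P')"
  by (erule trans_perm) simp_all

text \<open>The output binds into object and derivative but not into the subject, hence the empty
  permutation there. For inputs and \<open>ATau\<close> nothing is bound, and \<open>q\<close> fixes
  the free names of the residual.\<close>

lemma trans_rename_bn:
  assumes "trans S \<Psi> P \<alpha> P'" "finite X"
  obtains q where "trans S \<Psi> P (permAct [] q \<alpha>) (pP q P')" "permN q ` bnAct \<alpha> \<inter> X = {}"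
    "\<And>x. x \<in> X \<Longrightarrow> x \<notin> bnAct \<alpha> \<Longrightarrow> permN q x = x"
proof -
  let ?X = "X \<union> nAct S \<alpha> \<union> fnP S P'"
  obtain q where q: "permN q ` bnAct \<alpha> \<inter> ?X = {}"
    "\<And>x. x \<in> ?X \<Longrightarrow> x \<notin> bnAct \<alpha> \<Longrightarrow> permN q x = x"
    by (rule fresh_renaming_fixing[of "bnAct \<alpha>" ?X]) (use assms(2) in simp_all)
  have "alphaRes S \<alpha> P' (permAct [] q \<alpha>) (pP q P')"
  proof (cases \<alpha>)
    case (AOut M as N)
    have "fixes_names q ((suppT S N \<union> fnP S P') - set as)"
      using q(2) AOut by (simp add: fixes_names_def)
    then show ?thesis
      unfolding AOut permAct.simps permBy_Nil by (rule alphaRes_OutI) simp_all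
  next
    case (AIn K N)
    then have "pT q N = N" "alpha S (pP [] P') (pP q P')"
      using q(2) by (intro pT_fixes alpha_perm_cong; simp add: fixes_names_def)+
    then show ?thesis using AIn by simp
  next
    case ATau
    then have "alpha S (pP [] P') (pP q P')"
      using q(2) by (intro alpha_perm_cong) simp
    then show ?thesis using ATau by simp
  qed
  then have "trans S \<Psi> P (permAct [] q \<alpha>) (pP q P')"
    by (rule trans.Alpha[OF assms(1) alpha_refl])
  then show thesis by (rule that) (use q in auto)
qed

section \<open>Agents in parallel with assertions\<close>

definition assertPar :: "'a list \<Rightarrow> ('t,'c,'a) agent \<Rightarrow> ('t,'c,'a) agent" where
  "assertPar \<Psi>s P = foldr (\<lambda>\<Psi>. PPar (PAssert \<Psi>)) \<Psi>s P"

abbreviation "compList \<Psi>s \<equiv> foldr (comp S) \<Psi>s (unitA S)"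

abbreviation "suppAs \<Psi>s \<equiv> \<Union>\<Psi>\<in>set \<Psi>s. suppA S \<Psi>"

lemma assertPar_simps [simp]:
  "assertPar [] P = P" "assertPar (\<Psi> # \<Psi>s) P = PPar (PAssert \<Psi>) (assertPar \<Psi>s P)"
  by (simp_all add: assertPar_def)

lemma fnP_assertPar [simp]: "fnP S (assertPar \<Psi>s P) = suppAs \<Psi>s \<union> fnP S P"
  by (induction \<Psi>s) auto

lemma pP_assertPar [simp]: "pP p (assertPar \<Psi>s P) = assertPar (map (pA p) \<Psi>s) (pP p P)"
  by (induction \<Psi>s) auto

lemma pA_compList: "pA p (compList \<Psi>s) = compList (map (pA p) \<Psi>s)"
  by (induction \<Psi>s) auto

lemma unit_comp: "assert_eq S (comp S (unitA S) \<Psi>) \<Psi>"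
  using assert_eq_trans[OF comp_comm comp_unit] .

lemma foldr_comp_assert_eq: "assert_eq S (foldr (comp S) \<Psi>s \<Psi>0) (comp S (compList \<Psi>s) \<Psi>0)"
proof (induction \<Psi>s)
  case Nil
  then show ?case by (simp add: assert_eq_sym[OF unit_comp])
next
  case (Cons \<Psi> \<Psi>s)
  then show ?case
    using assert_eq_trans[OF comp_cong2 assert_eq_sym[OF comp_assoc]] by simp
qed

text \<open>Two foldings occur: frames of \<open>assertPar\<close> produce \<open>foldr\<close>,
  environments produce \<open>fold\<close>, because the outermost assertion joins the environment
  before the inner ones.\<close>

lemma fold_comp_assert_eq: "assert_eq S (fold (comp S) \<Psi>s \<Psi>0) (comp S (compList \<Psi>s) \<Psi>0)"
proof (induction \<Psi>s arbitrary: \<Psi>0)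
  case Nil
  then show ?case by (simp add: assert_eq_sym[OF unit_comp])
next
  case (Cons \<Psi> \<Psi>s)
  have "assert_eq S (fold (comp S) \<Psi>s (comp S \<Psi> \<Psi>0)) (comp S (comp S (compList \<Psi>s) \<Psi>) \<Psi>0)"
    using assert_eq_trans[OF Cons assert_eq_sym[OF comp_assoc]] .
  then show ?case
    using assert_eq_trans[OF _ comp_cong1[OF comp_comm]] by simp
qed

lemma fold_comp_unit: "assert_eq S (fold (comp S) \<Psi>s (unitA S)) (compList \<Psi>s)"
  using assert_eq_trans[OF fold_comp_assert_eq comp_unit] .

section \<open>Transitions of agents in parallel with assertions\<close>

lemma isFrame_PAssertE:
  assumes "isFrame S (PAssert \<Psi>) F"
  shows "F = ([], \<Psi>)"
proof -
  from assms have "alphaF S F ([], \<Psi>)" by cases simp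
  then have "alphaF S ([], \<Psi>) F" by (rule alphaF_sym)
  then show ?thesis by (auto simp: alphaF_iff_perm pA_fixes)
qed

lemma trans_PAssert: "\<not> trans S \<Psi>0 (PAssert \<Psi>) \<alpha> P'"
proof
  assume "trans S \<Psi>0 (PAssert \<Psi>) \<alpha> P'"
  then show False
    by (induction \<Psi>0 "PAssert \<Psi> :: ('t,'c,'a) agent" \<alpha> P' rule: trans.induct) (auto elim: alpha.cases)
qed

text \<open>An assertion has no transitions, which leaves rule \<open>Par2\<close> and
  alpha-conversion. Because of the latter the residual is determined only up to
  \<open>alphaRes\<close>.\<close>

lemma trans_PPar_PAssert:
  assumes "trans S \<Psi>0 (PPar (PAssert \<Psi>) P) \<beta> R"
  shows "\<exists>\<alpha> P'. trans S (comp S \<Psi> \<Psi>0) P \<alpha> P' \<and> bnAct \<alpha> \<inter> suppA S \<Psi> = {} \<and>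
    alphaRes S \<alpha> (PPar (PAssert \<Psi>) P') \<beta> R"
  using assms
proof (induction \<Psi>0 "PPar (PAssert \<Psi>) P" \<beta> R arbitrary: P rule: trans.induct)
  case (Par2 bP \<Psi>P \<Psi>0 P \<alpha> P')
  from isFrame_PAssertE[OF Par2.hyps(1)] have "\<Psi>P = \<Psi>" by simp
  then show ?case using Par2.hyps(3,5) alphaRes_alpha[OF alpha_refl] by (metis fnP.simps(8))
next
  case (Alpha \<Psi>0 P0 \<alpha> P' \<beta> R)
  from \<open>alpha S P0 (PPar (PAssert \<Psi>) P)\<close> obtain P1
    where P1: "P0 = PPar (PAssert \<Psi>) P1" "alpha S P1 P"
    by cases (auto elim: alpha.cases)
  from Alpha.hyps(2)[OF P1(1)] obtain \<gamma> P2 where *: "trans S (comp S \<Psi> \<Psi>0) P1 \<gamma> P2"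
    "bnAct \<gamma> \<inter> suppA S \<Psi> = {}" "alphaRes S \<gamma> (PPar (PAssert \<Psi>) P2) \<alpha> P'" by blast
  show ?case
    using trans_alpha[OF *(1) P1(2) alpha_refl] *(2) alphaRes_trans[OF *(3) Alpha.hyps(4)] by blast
qed (auto simp: trans_PAssert)

lemma alpha_PPar_PAssertE:
  assumes "alpha S (PPar (PAssert \<Psi>) P) R"
  obtains P' where "R = PPar (PAssert \<Psi>) P'" "alpha S P P'"
  using assms by cases (auto elim: alpha.cases)

lemma trans_PPar_PAssertE:
  assumes "trans S \<Psi>0 (PPar (PAssert \<Psi>) P) \<beta> R" "bnAct \<beta> \<inter> suppA S \<Psi> = {}"
  obtains P' where "R = PPar (PAssert \<Psi>) P'" "trans S (comp S \<Psi> \<Psi>0) P \<beta> P'"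
proof -
  obtain \<alpha> P' where *: "trans S (comp S \<Psi> \<Psi>0) P \<alpha> P'" "bnAct \<alpha> \<inter> suppA S \<Psi> = {}"
    "alphaRes S \<alpha> (PPar (PAssert \<Psi>) P') \<beta> R"
    using trans_PPar_PAssert[OF assms(1)] by blast
  have "\<exists>P''. R = PPar (PAssert \<Psi>) P'' \<and> alphaRes S \<alpha> P' \<beta> P''"
  proof (cases \<alpha>)
    case (AOut M as N)
    obtain p cs where p: "\<beta> = AOut M cs (pT p N)" "set cs = permN p ` set as"
      "fixes_names p ((suppT S N \<union> fnP S (PPar (PAssert \<Psi>) P')) - set as)"
      "alpha S (pP p (PPar (PAssert \<Psi>) P')) R"
      using *(3) unfolding AOut by (rule alphaRes_OutE)
    \<comment> \<open>The bound names of \<open>\<alpha>\<close> avoid \<open>\<Psi>\<close>, so the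
      names of \<open>\<Psi>\<close> are free in the residual and fixed by \<open>p\<close>; the
      parallel assertion survives the alpha-conversion unchanged.\<close>
    have "pA p \<Psi> = \<Psi>"
      using p(3) *(2) AOut by (intro pA_fixes) (auto simp: fixes_names_def)
    then obtain P'' where P'': "R = PPar (PAssert \<Psi>) P''" "alpha S (pP p P') P''"
      using p(4) by (auto elim: alpha_PPar_PAssertE)
    have "alphaRes S \<alpha> P' \<beta> P''"
      unfolding AOut p(1) using p(2,3) P''(2)
      by (intro alphaRes_OutI[where p=p]) (auto simp: fixes_names_def)
    then show ?thesis using P''(1) by blast
  next
    case (AIn M N)
    then show ?thesis using *(3) by (cases \<beta>) (auto elim: alpha_PPar_PAssertE)
  next
    case ATau
    then show ?thesis using *(3) by (cases \<beta>) (auto elim: alpha_PPar_PAssertE)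
  qed
  then show thesis using that trans.Alpha[OF *(1) alpha_refl] by blast
qed

lemma trans_assertPar_fold:
  assumes "trans S (fold (comp S) \<Psi>s \<Psi>0) P \<alpha> P'" "bnAct \<alpha> \<inter> suppAs \<Psi>s = {}"
  shows "trans S \<Psi>0 (assertPar \<Psi>s P) \<alpha> (assertPar \<Psi>s P')"
  using assms
proof (induction \<Psi>s arbitrary: \<Psi>0)
  case (Cons \<Psi> \<Psi>s)
  have "isFrame S (PAssert \<Psi>) ([], \<Psi>)"
    by (rule isFrame.fAssert) simp
  then show ?case unfolding assertPar_simps
    by (rule trans.Par2) (use Cons in auto)
qed simp

lemma trans_assertPar_foldE:
  assumes "trans S \<Psi>0 (assertPar \<Psi>s P) \<alpha> R" "bnAct \<alpha> \<inter> suppAs \<Psi>s = {}"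
  shows "\<exists>P'. R = assertPar \<Psi>s P' \<and> trans S (fold (comp S) \<Psi>s \<Psi>0) P \<alpha> P'"
  using assms
proof (induction \<Psi>s arbitrary: \<Psi>0 R)
  case (Cons \<Psi> \<Psi>s)
  have "bnAct \<alpha> \<inter> suppA S \<Psi> = {}" using Cons.prems(2) by auto
  with Cons.prems(1) obtain R' where R': "R = PPar (PAssert \<Psi>) R'"
    "trans S (comp S \<Psi> \<Psi>0) (assertPar \<Psi>s P) \<alpha> R'"
    unfolding assertPar_simps by (rule trans_PPar_PAssertE)
  then show ?case using Cons.IH[OF R'(2)] Cons.prems(2) by auto
qed simp

lemma trans_assertPar:
  assumes "assert_eq S \<Psi> (compList \<Psi>s)" "trans S \<Psi> P \<alpha> P'" "bnAct \<alpha> \<inter> suppAs \<Psi>s = {}"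
  shows "trans S (unitA S) (assertPar \<Psi>s P) \<alpha> (assertPar \<Psi>s P')"
  using trans_assert_eq[OF assert_eq_trans[OF fold_comp_unit assert_eq_sym[OF assms(1)]] assms(2)] assms(3)
  by (rule trans_assertPar_fold)

lemma trans_assertParE:
  assumes "assert_eq S \<Psi> (compList \<Psi>s)" "trans S (unitA S) (assertPar \<Psi>s P) \<alpha> R"
    "bnAct \<alpha> \<inter> suppAs \<Psi>s = {}"
  obtains P' where "R = assertPar \<Psi>s P'" "trans S \<Psi> P \<alpha> P'"
  using trans_assertPar_foldE[OF assms(2,3)]
    trans_assert_eq[OF assert_eq_trans[OF assms(1) assert_eq_sym[OF fold_comp_unit]]] by blast

section \<open>Frames of agents in parallel with assertions\<close>

lemma alphaF_comp:
  assumes "alphaF S (bs, \<Psi>) (cs, \<Psi>')" "set bs \<inter> suppA S \<Psi>0 = {}" "set cs \<inter> suppA S \<Psi>0 = {}"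
  shows "alphaF S (bs, comp S \<Psi>0 \<Psi>) (cs, comp S \<Psi>0 \<Psi>')"
proof -
  obtain p where p: "fixes_names p (suppA S \<Psi> - set bs)" "cs = map (permN p) bs" "\<Psi>' = pA p \<Psi>"
    using assms(1) unfolding alphaF_iff_perm by auto
  \<comment> \<open>As \<open>p\<close> may move names of \<open>\<Psi>0\<close>, it is replaced by
    a permutation that is the identity there. Freshness of both binder lists for
    \<open>\<Psi>0\<close> makes this injective and keeps the action on \<open>\<Psi>\<close> and
    \<open>bs\<close>.\<close>
  define f where "f x = (if x \<in> suppA S \<Psi>0 then x else permN p x)" for x
  have f: "f x = permN p x" if "x \<in> suppA S \<Psi> \<union> set bs" for x
    using that assms(2) p(1) by (cases "x \<in> set bs") (auto simp: f_def fixes_names_def)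
  have collide: False if "x \<in> suppA S \<Psi>0" "y \<in> suppA S \<Psi> \<union> set bs" "y \<notin> suppA S \<Psi>0" "x = permN p y" for x y
    using that p(1,2) assms(3) by (cases "y \<in> set bs") (auto simp: fixes_names_def)
  have "inj_on f (suppA S \<Psi> \<union> set bs \<union> suppA S \<Psi>0)"
    unfolding inj_on_def f_def using collide by (auto split: if_splits)
  then obtain q where q: "\<And>x. x \<in> suppA S \<Psi> \<union> set bs \<union> suppA S \<Psi>0 \<Longrightarrow> permN q x = f x"
    using perm_extending_injection[of "suppA S \<Psi> \<union> set bs \<union> suppA S \<Psi>0" f] by auto
  have "fixes_names q (suppA S (comp S \<Psi>0 \<Psi>) - set bs)"
    unfolding fixes_names_def
  proof
    fix x assume "x \<in> suppA S (comp S \<Psi>0 \<Psi>) - set bs"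
    then have "x \<in> suppA S \<Psi>0 \<or> x \<in> suppA S \<Psi> - set bs" using supp_comp by blast
    then show "permN q x = x"
      using q[of x] p(1) by (auto simp: f_def fixes_names_def)
  qed
  moreover have "map (permN q) bs = cs"
    using q f by (simp add: p(2))
  moreover have "pA q \<Psi>0 = \<Psi>0"
    using q by (intro pA_fixes) (simp add: fixes_names_def f_def)
  moreover have "pA q \<Psi> = \<Psi>'"
    unfolding p(3) using q f by (intro pA_cong) simp
  ultimately show ?thesis
    using alphaF_permI[of q "comp S \<Psi>0 \<Psi>" bs] by simp
qed

lemma isFrame_assertPar:
  assumes "isFrame S P (bs, \<Psi>)" "set bs \<inter> suppAs \<Psi>s = {}"
  shows "isFrame S (assertPar \<Psi>s P) (bs, foldr (comp S) \<Psi>s \<Psi>)"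
  using assms
proof (induction \<Psi>s)
  case (Cons \<Psi>0 \<Psi>s)
  have "isFrame S (PAssert \<Psi>0) ([], \<Psi>0)"
    by (rule isFrame.fAssert) simp
  moreover have "isFrame S (assertPar \<Psi>s P) (bs, foldr (comp S) \<Psi>s \<Psi>)"
    using Cons by auto
  ultimately show ?case unfolding assertPar_simps
    by (rule isFrame.fPar) (use Cons.prems(2) in auto)
qed simp

lemma isFrame_assertParE:
  assumes "isFrame S (assertPar \<Psi>s P) F" "finite X"
  shows "\<exists>bs \<Psi>. isFrame S P (bs, \<Psi>) \<and> set bs \<inter> X = {} \<and> alphaF S F (bs, foldr (comp S) \<Psi>s \<Psi>)"
  using assms
proof (induction \<Psi>s arbitrary: F X)
  case Nil
  obtain bs \<Psi> where F: "F = (bs, \<Psi>)" by (cases F)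
  have "isFrame S P (bs, \<Psi>)" using Nil F by simp
  then obtain s where "isFrame S P (map (permN s) bs, pA s \<Psi>)" "permN s ` set bs \<inter> X = {}"
    "fixes_names s (suppA S \<Psi> - set bs)"
    using isFrame_fresh[OF _ Nil.prems(2)] by metis
  then show ?case
    unfolding F using alphaF_permI[of s \<Psi> bs]
    by (intro exI[of _ "map (permN s) bs"] exI[of _ "pA s \<Psi>"]) simp
next
  case (Cons \<Psi>0 \<Psi>s)
  from Cons.prems(1) obtain b1 \<Psi>1 b2 \<Psi>2 where *: "isFrame S (PAssert \<Psi>0) (b1, \<Psi>1)"
    "isFrame S (assertPar \<Psi>s P) (b2, \<Psi>2)" "set b2 \<inter> (set b1 \<union> suppA S \<Psi>1) = {}"
    "alphaF S F (b1 @ b2, comp S \<Psi>1 \<Psi>2)"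
    unfolding assertPar_simps by cases blast
  have [simp]: "b1 = []" "\<Psi>1 = \<Psi>0" using isFrame_PAssertE[OF *(1)] by simp_all
  \<comment> \<open>The binders are kept away from \<open>\<Psi>0\<close> as well, which
    \<open>alphaF_comp\<close> demands when that assertion is added in front.\<close>
  obtain bs \<Psi> where IH: "isFrame S P (bs, \<Psi>)" "set bs \<inter> (X \<union> suppA S \<Psi>0) = {}"
    "alphaF S (b2, \<Psi>2) (bs, foldr (comp S) \<Psi>s \<Psi>)"
    using Cons.IH[OF *(2), of "X \<union> suppA S \<Psi>0"] Cons.prems(2) by auto
  have "alphaF S (b2, comp S \<Psi>0 \<Psi>2) (bs, comp S \<Psi>0 (foldr (comp S) \<Psi>s \<Psi>))"
    using IH(2) *(3) by (intro alphaF_comp[OF IH(3)]) auto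
  then have "alphaF S F (bs, foldr (comp S) (\<Psi>0 # \<Psi>s) \<Psi>)"
    using alphaF_trans[OF *(4)] by simp
  then show ?case using IH by blast
qed

lemma compList_frame_assert_eq:
  assumes "assert_eq S \<Psi> (compList \<Psi>s)"
  shows "assert_eq S (comp S \<Psi> \<Psi>') (foldr (comp S) \<Psi>s \<Psi>')"
  using assert_eq_trans[OF comp_cong1[OF assms] assert_eq_sym[OF foldr_comp_assert_eq]] .

text \<open>The condition \<open>\<phi>\<close> is fixed beforehand and \<open>F'\<close> may depend
  on it: with binders fresh for \<open>\<phi>\<close>, entailment by a frame is entailment by its
  assertion, where equivalence of assertions applies.\<close>

lemma extFrame_imp_isFrame_assertPar:
  assumes "assert_eq S \<Psi> (compList \<Psi>s)" "extFrame S \<Psi> P F"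
  obtains F' where "isFrame S (assertPar \<Psi>s P) F'" "frame_ent S F \<phi> \<longleftrightarrow> frame_ent S F' \<phi>"
proof -
  obtain bs \<Psi>P where F: "isFrame S P (bs, \<Psi>P)" "set bs \<inter> suppA S \<Psi> = {}"
    "alphaF S F (bs, comp S \<Psi> \<Psi>P)"
    using assms(2) unfolding extFrame_def by blast
  obtain s where s: "isFrame S P (map (permN s) bs, pA s \<Psi>P)"
    "permN s ` set bs \<inter> (suppC S \<phi> \<union> suppA S \<Psi> \<union> suppAs \<Psi>s) = {}"
    "fixes_names s (suppA S \<Psi>P - set bs)"
    by (rule isFrame_fresh[OF F(1), of "suppC S \<phi> \<union> suppA S \<Psi> \<union> suppAs \<Psi>s"]) auto
  let ?bs = "map (permN s) bs"
  have "alphaF S (bs, comp S \<Psi> \<Psi>P) (?bs, comp S \<Psi> (pA s \<Psi>P))"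
    using F(2) s(2) by (intro alphaF_comp alphaF_permI s(3)) auto
  from frame_ent_alphaF[OF alphaF_trans[OF F(3) this], of \<phi>]
  have "frame_ent S F \<phi> \<longleftrightarrow> ent S (comp S \<Psi> (pA s \<Psi>P)) \<phi>"
    using frame_ent_fresh[of ?bs \<phi>] s(2) by auto
  also have "\<dots> \<longleftrightarrow> ent S (foldr (comp S) \<Psi>s (pA s \<Psi>P)) \<phi>"
    using compList_frame_assert_eq[OF assms(1)] by (simp add: assert_eq_def)
  also have "\<dots> \<longleftrightarrow> frame_ent S (?bs, foldr (comp S) \<Psi>s (pA s \<Psi>P)) \<phi>"
    using s(2) by (intro frame_ent_fresh[symmetric]) auto
  finally have "frame_ent S F \<phi> \<longleftrightarrow> \<dots>" .
  moreover have "isFrame S (assertPar \<Psi>s P) (?bs, foldr (comp S) \<Psi>s (pA s \<Psi>P))"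
    using s(2) by (intro isFrame_assertPar s(1)) auto
  ultimately show thesis using that by blast
qed

lemma isFrame_assertPar_imp_extFrame:
  assumes "assert_eq S \<Psi> (compList \<Psi>s)" "isFrame S (assertPar \<Psi>s P) F"
  obtains F' where "extFrame S \<Psi> P F'" "frame_ent S F \<phi> \<longleftrightarrow> frame_ent S F' \<phi>"
proof -
  obtain bs \<Psi>P where F: "isFrame S P (bs, \<Psi>P)" "set bs \<inter> (suppC S \<phi> \<union> suppA S \<Psi>) = {}"
    "alphaF S F (bs, foldr (comp S) \<Psi>s \<Psi>P)"
    using isFrame_assertParE[OF assms(2), of "suppC S \<phi> \<union> suppA S \<Psi>"] by auto
  have fresh: "set bs \<inter> suppC S \<phi> = {}" using F(2) by auto
  have "frame_ent S F \<phi> \<longleftrightarrow> ent S (foldr (comp S) \<Psi>s \<Psi>P) \<phi>"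
    using frame_ent_alphaF[OF F(3)] frame_ent_fresh[OF fresh] by simp
  also have "\<dots> \<longleftrightarrow> ent S (comp S \<Psi> \<Psi>P) \<phi>"
    using compList_frame_assert_eq[OF assms(1)] by (simp add: assert_eq_def)
  also have "\<dots> \<longleftrightarrow> frame_ent S (bs, comp S \<Psi> \<Psi>P) \<phi>"
    by (rule frame_ent_fresh[OF fresh, symmetric])
  finally have "frame_ent S F \<phi> \<longleftrightarrow> \<dots>" .
  moreover have "extFrame S \<Psi> P (bs, comp S \<Psi> \<Psi>P)"
    unfolding extFrame_def using F(1,2) by (intro exI[of _ bs] exI[of _ \<Psi>P]) auto
  ultimately show thesis using that by blast
qed

section \<open>Equivariance of the bisimilarities\<close>

abbreviation "permF p F \<equiv> (map (permN p) (fst F), pA p (snd F))"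

lemma frame_ent_permI: "frame_ent S F \<phi> \<Longrightarrow> frame_ent S (permF p F) (pC p \<phi>)"
proof -
  assume "frame_ent S F \<phi>"
  then obtain bs \<Psi> where *: "alphaF S F (bs, \<Psi>)" "set bs \<inter> suppC S \<phi> = {}" "ent S \<Psi> \<phi>"
    unfolding frame_ent_def by blast
  show ?thesis
    unfolding frame_ent_def using * alphaF_perm[OF *(1), of p]
    by (intro exI[of _ "map (permN p) bs"] exI[of _ "pA p \<Psi>"]) simp
qed

lemma frame_ent_perm: "frame_ent S (permF p F) (pC p \<phi>) \<longleftrightarrow> frame_ent S F \<phi>"
  using frame_ent_permI[of F \<phi> p] frame_ent_permI[of "permF p F" "pC p \<phi>" "rev p"]
  by (auto simp: o_def)

lemma frame_eq_permD: "frame_eq S (permF p F) (permF p G) \<Longrightarrow> frame_eq S F G"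
  unfolding frame_eq_def using frame_ent_perm by blast

lemma extFrame_perm: "extFrame S \<Psi> P F \<Longrightarrow> extFrame S (pA p \<Psi>) (pP p P) (permF p F)"
proof -
  assume "extFrame S \<Psi> P F"
  then obtain bs \<Psi>P where *: "isFrame S P (bs, \<Psi>P)" "set bs \<inter> suppA S \<Psi> = {}"
    "alphaF S F (bs, comp S \<Psi> \<Psi>P)"
    unfolding extFrame_def by blast
  then show ?thesis
    unfolding extFrame_def using isFrame_perm[OF *(1), of p] alphaF_perm[OF *(3), of p]
    by (intro exI[of _ "map (permN p) bs"] exI[of _ "pA p \<Psi>P"]) simp
qed

lemma is_bisimulation_bisim: "is_bisimulation S (bisim S)"
  unfolding is_bisimulation_def
proof (intro allI impI)
  fix \<Psi> P Q assume "bisim S \<Psi> P Q"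
  then obtain R where R: "is_bisimulation S R" "R \<Psi> P Q"
    unfolding bisim_def by blast
  have "R \<Psi>' P' Q' \<Longrightarrow> bisim S \<Psi>' P' Q'" for \<Psi>' P' Q'
    using R(1) unfolding bisim_def by blast
  with R(1)[unfolded is_bisimulation_def, rule_format, OF R(2)]
  show "(\<forall>F G. extFrame S \<Psi> P F \<longrightarrow> extFrame S \<Psi> Q G \<longrightarrow> frame_eq S F G) \<and>
    bisim S \<Psi> Q P \<and> (\<forall>\<Psi>'. bisim S (comp S \<Psi> \<Psi>') P Q) \<and>
    (\<forall>\<alpha> P'. bnAct \<alpha> \<inter> (suppA S \<Psi> \<union> fnP S Q) = {} \<longrightarrow> trans S \<Psi> P \<alpha> P' \<longrightarrow>
      (\<exists>Q'. trans S \<Psi> Q \<alpha> Q' \<and> bisim S \<Psi> P' Q'))"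
    by blast
qed

lemmas bisim_unfold = is_bisimulation_bisim[unfolded is_bisimulation_def, rule_format]

lemma bisim_frame_eq:
  "bisim S \<Psi> P Q \<Longrightarrow> extFrame S \<Psi> P F \<Longrightarrow> extFrame S \<Psi> Q G \<Longrightarrow> frame_eq S F G"
  using bisim_unfold by blast

lemma bisim_sym: "bisim S \<Psi> P Q \<Longrightarrow> bisim S \<Psi> Q P"
  using bisim_unfold by blast

lemma bisim_comp: "bisim S \<Psi> P Q \<Longrightarrow> bisim S (comp S \<Psi> \<Psi>') P Q"
  using bisim_unfold by blast

lemma bisim_sim:
  assumes "bisim S \<Psi> P Q" "trans S \<Psi> P \<alpha> P'" "bnAct \<alpha> \<inter> (suppA S \<Psi> \<union> fnP S Q) = {}"
  obtains Q' where "trans S \<Psi> Q \<alpha> Q'" "bisim S \<Psi> P' Q'"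
  using bisim_unfold[OF assms(1)] assms(2,3) by blast

lemma is_ctx_bisimulation_ctx_bisim: "is_ctx_bisimulation S (ctx_bisim S)"
  unfolding is_ctx_bisimulation_def
proof (intro allI impI)
  fix P Q assume "ctx_bisim S P Q"
  then obtain R where R: "is_ctx_bisimulation S R" "R P Q"
    unfolding ctx_bisim_def by blast
  have "R P' Q' \<Longrightarrow> ctx_bisim S P' Q'" for P' Q'
    using R(1) unfolding ctx_bisim_def by blast
  with R(1)[unfolded is_ctx_bisimulation_def, rule_format, OF R(2)]
  show "(\<forall>F G. isFrame S P F \<longrightarrow> isFrame S Q G \<longrightarrow> frame_eq S F G) \<and>
    ctx_bisim S Q P \<and> (\<forall>\<Psi>. ctx_bisim S (PPar (PAssert \<Psi>) P) (PPar (PAssert \<Psi>) Q)) \<and>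
    (\<forall>\<alpha> P'. bnAct \<alpha> \<inter> fnP S Q = {} \<longrightarrow> trans S (unitA S) P \<alpha> P' \<longrightarrow>
      (\<exists>Q'. trans S (unitA S) Q \<alpha> Q' \<and> ctx_bisim S P' Q'))"
    by blast
qed

lemmas ctx_bisim_unfold = is_ctx_bisimulation_ctx_bisim[unfolded is_ctx_bisimulation_def, rule_format]

lemma ctx_bisim_frame_eq:
  "ctx_bisim S P Q \<Longrightarrow> isFrame S P F \<Longrightarrow> isFrame S Q G \<Longrightarrow> frame_eq S F G"
  using ctx_bisim_unfold by blast

lemma ctx_bisim_sym: "ctx_bisim S P Q \<Longrightarrow> ctx_bisim S Q P"
  using ctx_bisim_unfold by blast

lemma ctx_bisim_PAssert:
  "ctx_bisim S P Q \<Longrightarrow> ctx_bisim S (PPar (PAssert \<Psi>) P) (PPar (PAssert \<Psi>) Q)"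
  using ctx_bisim_unfold by blast

lemma ctx_bisim_sim:
  assumes "ctx_bisim S P Q" "trans S (unitA S) P \<alpha> P'" "bnAct \<alpha> \<inter> fnP S Q = {}"
  obtains Q' where "trans S (unitA S) Q \<alpha> Q'" "ctx_bisim S P' Q'"
  using ctx_bisim_unfold[OF assms(1)] assms(2,3) by blast

text \<open>The candidate relation is the preimage of bisimilarity under the inverse
  permutation.\<close>

lemma bisim_perm:
  assumes "bisim S \<Psi> P Q"
  shows "bisim S (pA p \<Psi>) (pP p P) (pP p Q)"
proof -
  let ?R = "\<lambda>\<Psi> P Q. bisim S (pA (rev p) \<Psi>) (pP (rev p) P) (pP (rev p) Q)"
  have "is_bisimulation S ?R"
    unfolding is_bisimulation_def
  proof (intro allI impI conjI)
    fix \<Psi> P Q assume PQ: "?R \<Psi> P Q"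
    show "frame_eq S F G" if "extFrame S \<Psi> P F" "extFrame S \<Psi> Q G" for F G
      by (rule frame_eq_permD[OF bisim_frame_eq[OF PQ extFrame_perm[OF that(1)] extFrame_perm[OF that(2)]]])
    show "?R \<Psi> Q P"
      using PQ by (rule bisim_sym)
    show "?R (comp S \<Psi> \<Psi>') P Q" for \<Psi>'
      using bisim_comp[OF PQ] by simp
    fix \<alpha> P' assume \<alpha>: "bnAct \<alpha> \<inter> (suppA S \<Psi> \<union> fnP S Q) = {}" "trans S \<Psi> P \<alpha> P'"
    let ?\<alpha> = "permAct (rev p) (rev p) \<alpha>"
    have "bnAct ?\<alpha> \<inter> (suppA S (pA (rev p) \<Psi>) \<union> fnP S (pP (rev p) Q)) = {}"
      using \<alpha>(1) by (simp flip: image_Un)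
    then obtain Q' where Q': "trans S (pA (rev p) \<Psi>) (pP (rev p) Q) ?\<alpha> Q'"
      "bisim S (pA (rev p) \<Psi>) (pP (rev p) P') Q'"
      by (rule bisim_sim[OF PQ trans_equivariant[OF \<alpha>(2), of "rev p"]])
    have "trans S \<Psi> Q \<alpha> (pP p Q')"
      using trans_equivariant[OF Q'(1), of p] permAct_rev(1)[of "rev p" "rev p" \<alpha>] by simp
    then show "\<exists>Q'. trans S \<Psi> Q \<alpha> Q' \<and> ?R \<Psi> P' Q'"
      using Q'(2) by (intro exI[of _ "pP p Q'"]) simp
  qed
  then show ?thesis
    unfolding bisim_def[of S "pA p \<Psi>"] using assms by (intro exI[of _ ?R]) simp
qed

lemma ctx_bisim_perm:
  assumes "ctx_bisim S P Q"
  shows "ctx_bisim S (pP p P) (pP p Q)"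
proof -
  let ?R = "\<lambda>P Q. ctx_bisim S (pP (rev p) P) (pP (rev p) Q)"
  have "is_ctx_bisimulation S ?R"
    unfolding is_ctx_bisimulation_def
  proof (intro allI impI conjI)
    fix P Q assume PQ: "?R P Q"
    show "frame_eq S F G" if "isFrame S P F" "isFrame S Q G" for F G
      by (rule frame_eq_permD[OF ctx_bisim_frame_eq[OF PQ isFrame_perm[OF that(1)] isFrame_perm[OF that(2)]]])
    show "?R Q P"
      using PQ by (rule ctx_bisim_sym)
    show "?R (PPar (PAssert \<Psi>) P) (PPar (PAssert \<Psi>) Q)" for \<Psi>
      using ctx_bisim_PAssert[OF PQ] by simp
    fix \<alpha> P' assume \<alpha>: "bnAct \<alpha> \<inter> fnP S Q = {}" "trans S (unitA S) P \<alpha> P'"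
    let ?\<alpha> = "permAct (rev p) (rev p) \<alpha>"
    have fresh: "bnAct ?\<alpha> \<inter> fnP S (pP (rev p) Q) = {}"
      using \<alpha>(1) by simp
    have "trans S (unitA S) (pP (rev p) P) ?\<alpha> (pP (rev p) P')"
      using trans_equivariant[OF \<alpha>(2), of "rev p"] by simp
    from PQ this fresh obtain Q' where Q': "trans S (unitA S) (pP (rev p) Q) ?\<alpha> Q'"
      "ctx_bisim S (pP (rev p) P') Q'"
      by (rule ctx_bisim_sim)
    have "trans S (unitA S) Q \<alpha> (pP p Q')"
      using trans_equivariant[OF Q'(1), of p] permAct_rev(1)[of "rev p" "rev p" \<alpha>] by simp
    then show "\<exists>Q'. trans S (unitA S) Q \<alpha> Q' \<and> ?R P' Q'"
      using Q'(2) by (intro exI[of _ "pP p Q'"]) simp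
  qed
  then show ?thesis
    unfolding ctx_bisim_def[of S "pP p P"] using assms by (intro exI[of _ ?R]) simp
qed

section \<open>Coincidence of the bisimilarities\<close>

text \<open>Only the residual is renamed back, by \<open>trans_perm\<close> with the empty
  permutation for agent and environment; this is possible because \<open>q\<close> fixes the free
  names of \<open>Q\<close>.\<close>

lemma trans_rename_bn_back:
  assumes "trans S \<Psi> Q (permAct [] q \<alpha>) Q'" "\<And>x. x \<in> fnP S Q \<Longrightarrow> permN q x = x"
  shows "trans S \<Psi> Q \<alpha> (pP (rev q) Q')"
proof -
  have "permN (rev q) x = x" if "x \<in> fnP S Q" for x
    using permN_rev[of q x] assms(2)[OF that] by simp
  then show ?thesis
    using trans_perm[OF assms(1), of "[]" "rev q" \<Psi>] by simp
qed

lemma bisim_imp_ctx_bisim: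
  assumes "bisim S (unitA S) P Q"
  shows "ctx_bisim S P Q"
proof -
  \<comment> \<open>The environment is kept as an assertion of its own: bisimulations compose on the
    right whereas parallel assertions are added on the left, and renaming may change
    \<open>\<Psi>\<close> while the list stays.\<close>
  define R where "R P Q \<longleftrightarrow> (\<exists>\<Psi>s P0 Q0 \<Psi>. P = assertPar \<Psi>s P0 \<and> Q = assertPar \<Psi>s Q0 \<and>
    assert_eq S \<Psi> (compList \<Psi>s) \<and> bisim S \<Psi> P0 Q0)" for P Q
  have RI: "R (assertPar \<Psi>s P) (assertPar \<Psi>s Q)"
    if "assert_eq S \<Psi> (compList \<Psi>s)" "bisim S \<Psi> P Q" for \<Psi> \<Psi>s P Q
    using that unfolding R_def by blast
  have "is_ctx_bisimulation S R"
    unfolding is_ctx_bisimulation_def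
  proof (intro allI impI conjI)
    fix P1 Q1 assume "R P1 Q1"
    then obtain \<Psi>s P Q \<Psi> where PQ: "P1 = assertPar \<Psi>s P" "Q1 = assertPar \<Psi>s Q"
      and \<Psi>: "assert_eq S \<Psi> (compList \<Psi>s)" and bisim: "bisim S \<Psi> P Q"
      unfolding R_def by blast
    show "frame_eq S F G" if F: "isFrame S P1 F" and G: "isFrame S Q1 G" for F G
      unfolding frame_eq_def
    proof
      fix \<phi>
      obtain F' where F': "extFrame S \<Psi> P F'" "frame_ent S F \<phi> \<longleftrightarrow> frame_ent S F' \<phi>"
        using isFrame_assertPar_imp_extFrame[OF \<Psi> F[unfolded PQ]] .
      obtain G' where G': "extFrame S \<Psi> Q G'" "frame_ent S G \<phi> \<longleftrightarrow> frame_ent S G' \<phi>"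
        using isFrame_assertPar_imp_extFrame[OF \<Psi> G[unfolded PQ]] .
      have "frame_eq S F' G'"
        using bisim F'(1) G'(1) by (rule bisim_frame_eq)
      then show "frame_ent S F \<phi> \<longleftrightarrow> frame_ent S G \<phi>"
        unfolding F'(2) G'(2) frame_eq_def by blast
    qed
    show "R Q1 P1"
      unfolding PQ using \<Psi> bisim_sym[OF bisim] by (rule RI)
    show "R (PPar (PAssert \<Psi>') P1) (PPar (PAssert \<Psi>') Q1)" for \<Psi>'
    proof -
      have "assert_eq S (comp S \<Psi> \<Psi>') (compList (\<Psi>' # \<Psi>s))"
        using assert_eq_trans[OF comp_cong1[OF \<Psi>] comp_comm] by simp
      moreover have "bisim S (comp S \<Psi> \<Psi>') P Q"
        using bisim by (rule bisim_comp)
      ultimately show ?thesis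
        unfolding PQ using RI[of "comp S \<Psi> \<Psi>'" "\<Psi>' # \<Psi>s"] by simp
    qed
    fix \<alpha> P1' assume \<alpha>: "bnAct \<alpha> \<inter> fnP S Q1 = {}" "trans S (unitA S) P1 \<alpha> P1'"
    have fresh: "bnAct \<alpha> \<inter> suppAs \<Psi>s = {}" "bnAct \<alpha> \<inter> fnP S Q = {}"
      using \<alpha>(1) unfolding PQ by auto
    obtain P' where P': "P1' = assertPar \<Psi>s P'" "trans S \<Psi> P \<alpha> P'"
      using trans_assertParE[OF \<Psi> \<alpha>(2)[unfolded PQ] fresh(1)] .
    \<comment> \<open>The bound names avoid the list and \<open>Q\<close> but possibly not
      \<open>\<Psi>\<close>, so they are renamed before bisimilarity in \<open>\<Psi>\<close> is
      used.\<close>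
    obtain q where q: "trans S \<Psi> P (permAct [] q \<alpha>) (pP q P')"
      "permN q ` bnAct \<alpha> \<inter> (suppA S \<Psi> \<union> suppAs \<Psi>s \<union> fnP S Q) = {}"
      "\<And>x. x \<in> suppA S \<Psi> \<union> suppAs \<Psi>s \<union> fnP S Q \<Longrightarrow> x \<notin> bnAct \<alpha> \<Longrightarrow> permN q x = x"
      by (rule trans_rename_bn[OF P'(2), of "suppA S \<Psi> \<union> suppAs \<Psi>s \<union> fnP S Q"]) simp_all
    have "bnAct (permAct [] q \<alpha>) \<inter> (suppA S \<Psi> \<union> fnP S Q) = {}"
      unfolding bnAct_permAct using q(2) by blast
    with bisim q(1) obtain Q' where Q': "trans S \<Psi> Q (permAct [] q \<alpha>) Q'" "bisim S \<Psi> (pP q P') Q'"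
      by (rule bisim_sim)
    have "trans S \<Psi> Q \<alpha> (pP (rev q) Q')"
      using q(3) fresh(2) by (intro trans_rename_bn_back[OF Q'(1)]) blast
    then have "trans S (unitA S) Q1 \<alpha> (assertPar \<Psi>s (pP (rev q) Q'))"
      unfolding PQ using fresh(1) by (rule trans_assertPar[OF \<Psi>])
    moreover have "R P1' (assertPar \<Psi>s (pP (rev q) Q'))"
    proof -
      \<comment> \<open>Undoing the renaming may alter \<open>\<Psi>\<close> but not the list, whose
        names \<open>q\<close> fixes; the altered environment is still equivalent to the same
        composition.\<close>
      have "map (pA (rev q)) \<Psi>s = \<Psi>s"
        using q(3) fresh(1) by (intro map_idI pA_fixes fixes_rev) (auto simp: fixes_names_def)
      then have "assert_eq S (pA (rev q) \<Psi>) (compList \<Psi>s)"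
        using assert_eq_perm[OF \<Psi>, of "rev q"] by (simp add: pA_compList)
      moreover have "bisim S (pA (rev q) \<Psi>) P' (pP (rev q) Q')"
        using bisim_perm[OF Q'(2), of "rev q"] by simp
      ultimately show ?thesis unfolding P'(1) by (rule RI)
    qed
    ultimately show "\<exists>Q'. trans S (unitA S) Q1 \<alpha> Q' \<and> R P1' Q'" by blast
  qed
  moreover have "R P Q"
    using RI[of "unitA S" "[]"] assms by simp
  ultimately show ?thesis unfolding ctx_bisim_def by blast
qed

lemma ctx_bisim_imp_bisim:
  assumes "ctx_bisim S P Q"
  shows "bisim S (unitA S) P Q"
proof -
  define R where "R \<Psi> P Q \<longleftrightarrow> (\<exists>\<Psi>s. assert_eq S \<Psi> (compList \<Psi>s) \<and>
    ctx_bisim S (assertPar \<Psi>s P) (assertPar \<Psi>s Q))" for \<Psi> P Q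
  have RI: "R \<Psi> P Q"
    if "assert_eq S \<Psi> (compList \<Psi>s)" "ctx_bisim S (assertPar \<Psi>s P) (assertPar \<Psi>s Q)" for \<Psi> \<Psi>s P Q
    using that unfolding R_def by blast
  have "is_bisimulation S R"
    unfolding is_bisimulation_def
  proof (intro allI impI conjI)
    fix \<Psi> P Q assume "R \<Psi> P Q"
    then obtain \<Psi>s where \<Psi>: "assert_eq S \<Psi> (compList \<Psi>s)"
      and ctx: "ctx_bisim S (assertPar \<Psi>s P) (assertPar \<Psi>s Q)"
      unfolding R_def by blast
    show "frame_eq S F G" if F: "extFrame S \<Psi> P F" and G: "extFrame S \<Psi> Q G" for F G
      unfolding frame_eq_def
    proof
      fix \<phi>
      obtain F' where F': "isFrame S (assertPar \<Psi>s P) F'" "frame_ent S F \<phi> \<longleftrightarrow> frame_ent S F' \<phi>"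
        using extFrame_imp_isFrame_assertPar[OF \<Psi> F] .
      obtain G' where G': "isFrame S (assertPar \<Psi>s Q) G'" "frame_ent S G \<phi> \<longleftrightarrow> frame_ent S G' \<phi>"
        using extFrame_imp_isFrame_assertPar[OF \<Psi> G] .
      have "frame_eq S F' G'"
        using ctx F'(1) G'(1) by (rule ctx_bisim_frame_eq)
      then show "frame_ent S F \<phi> \<longleftrightarrow> frame_ent S G \<phi>"
        unfolding F'(2) G'(2) frame_eq_def by blast
    qed
    show "R \<Psi> Q P"
      using \<Psi> ctx_bisim_sym[OF ctx] by (rule RI)
    show "R (comp S \<Psi> \<Psi>') P Q" for \<Psi>'
    proof (rule RI)
      show "assert_eq S (comp S \<Psi> \<Psi>') (compList (\<Psi>' # \<Psi>s))"
        using assert_eq_trans[OF comp_cong1[OF \<Psi>] comp_comm] by simp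
      show "ctx_bisim S (assertPar (\<Psi>' # \<Psi>s) P) (assertPar (\<Psi>' # \<Psi>s) Q)"
        unfolding assertPar_simps using ctx by (rule ctx_bisim_PAssert)
    qed
    fix \<alpha> P' assume \<alpha>: "bnAct \<alpha> \<inter> (suppA S \<Psi> \<union> fnP S Q) = {}" "trans S \<Psi> P \<alpha> P'"
    \<comment> \<open>Here the bound names avoid \<open>\<Psi>\<close> and \<open>Q\<close>, but
      possibly not the assertions of the list.\<close>
    obtain q where q: "trans S \<Psi> P (permAct [] q \<alpha>) (pP q P')"
      "permN q ` bnAct \<alpha> \<inter> (suppA S \<Psi> \<union> suppAs \<Psi>s \<union> fnP S Q) = {}"
      "\<And>x. x \<in> suppA S \<Psi> \<union> suppAs \<Psi>s \<union> fnP S Q \<Longrightarrow> x \<notin> bnAct \<alpha> \<Longrightarrow> permN q x = x"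
      by (rule trans_rename_bn[OF \<alpha>(2), of "suppA S \<Psi> \<union> suppAs \<Psi>s \<union> fnP S Q"]) simp_all
    have fresh: "bnAct (permAct [] q \<alpha>) \<inter> suppAs \<Psi>s = {}"
      unfolding bnAct_permAct using q(2) by blast
    have "trans S (unitA S) (assertPar \<Psi>s P) (permAct [] q \<alpha>) (assertPar \<Psi>s (pP q P'))"
      using q(1) fresh by (rule trans_assertPar[OF \<Psi>])
    moreover have "bnAct (permAct [] q \<alpha>) \<inter> fnP S (assertPar \<Psi>s Q) = {}"
      unfolding bnAct_permAct fnP_assertPar using q(2) by blast
    ultimately obtain Q1 where Q1: "trans S (unitA S) (assertPar \<Psi>s Q) (permAct [] q \<alpha>) Q1"
      "ctx_bisim S (assertPar \<Psi>s (pP q P')) Q1"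
      by (rule ctx_bisim_sim[OF ctx])
    obtain Q' where Q': "Q1 = assertPar \<Psi>s Q'" "trans S \<Psi> Q (permAct [] q \<alpha>) Q'"
      using trans_assertParE[OF \<Psi> Q1(1) fresh] .
    have "trans S \<Psi> Q \<alpha> (pP (rev q) Q')"
      using q(3) \<alpha>(1) by (intro trans_rename_bn_back[OF Q'(2)]) blast
    moreover have "R \<Psi> P' (pP (rev q) Q')"
    proof (rule RI)
      \<comment> \<open>Dually, \<open>\<Psi>\<close> is fixed and the list may change; the permuted
        list still composes to an assertion equivalent to \<open>\<Psi>\<close>, and
        \<open>R\<close> leaves the choice of the list open.\<close>
      have "pA (rev q) \<Psi> = \<Psi>"
        using q(3) \<alpha>(1) by (intro pA_fixes fixes_rev) (auto simp: fixes_names_def)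
      then show "assert_eq S \<Psi> (compList (map (pA (rev q)) \<Psi>s))"
        using assert_eq_perm[OF \<Psi>, of "rev q"] by (simp add: pA_compList)
      show "ctx_bisim S (assertPar (map (pA (rev q)) \<Psi>s) P') (assertPar (map (pA (rev q)) \<Psi>s) (pP (rev q) Q'))"
        using ctx_bisim_perm[OF Q1(2), of "rev q"] unfolding Q'(1) by simp
    qed
    ultimately show "\<exists>Q'. trans S \<Psi> Q \<alpha> Q' \<and> R \<Psi> P' Q'" by blast
  qed
  moreover have "R (unitA S) P Q"
    using RI[of "unitA S" "[]"] assms by simp
  ultimately show ?thesis unfolding bisim_def by blast
qed

end

theorem mainTheorem1:
  fixes S :: "('t,'c,'a) psi_ops" and P Q :: "('t,'c,'a) agent"
  assumes "psi_calculus S"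
    and "wf_agent S P" and "wf_agent S Q"
  shows "bisim S (unitA S) P Q \<longleftrightarrow> ctx_bisim S P Q"
proof -
  interpret psi S by unfold_locales (rule assms(1))
  show ?thesis using bisim_imp_ctx_bisim ctx_bisim_imp_bisim by blast
qed

end
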